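(* Let $R$ be a complete discrete valuation ring whose residue field is finite of odd cardinality $q$, with fraction field $K$ of characteristic different from $2$. Let $f$ be a nondegenerate $n$-ary quadratic form over $R$ that is anisotropic and ADC. (a) If $n=2$, then $\delta_v(f)\in\{\frac{q}{q+1},\frac12,\frac{1}{q+1}\}$, and each of these values occurs. (b) If $n=3$, then $\delta_v(f)\in\{\frac{q+2}{2q+2},\frac{2q+1}{2q+2}\}$, and both values occur. (c) If $n\geq 4$, then $\delta_v(f)=1$.
   Context: $f$ over $R$ is ADC if every $x\in R$ of the form $f(w)$ with $w\in K^n$ is of the form $f(w')$ with $w'\in R^n$. $D_f\coloneqq f(R^n)\setminus\{0\}$; $\mu$ is the Haar measure on $R$ with $\mu(R)=1$; $\delta_v(f)\coloneqq\mu(D_f)$. "Occurs" means there is an anisotropic ADC form over $R$ of the given number of variables with that value. *)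

theory Defs
  imports
    "HOL-Analysis.Analysis"
    "HOL-Computational_Algebra.Computational_Algebra"
begin

section \<open>Complete discrete valuation rings\<close>

text \<open>
  A commutative ring is a module over itself; its submodules are the ideals and
  \<open>module.span (*)\<close> is the ideal generated by a set.
\<close>

definition ring_ideal :: "'r::comm_ring_1 set \<Rightarrow> bool" where
  "ring_ideal I \<longleftrightarrow> module.subspace (*) I"

definition maximal_ring_ideal :: "'r::comm_ring_1 set \<Rightarrow> bool" where
  "maximal_ring_ideal I \<longleftrightarrow> ring_ideal I \<and> I \<noteq> UNIV \<and>
     (\<forall>J. ring_ideal J \<and> I \<subseteq> J \<longrightarrow> J = I \<or> J = UNIV)"

fun ideal_power :: "'r::comm_ring_1 set \<Rightarrow> nat \<Rightarrow> 'r set" where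
  "ideal_power I 0 = UNIV"
| "ideal_power I (Suc k) = module.span (*) {x * y | x y. x \<in> I \<and> y \<in> ideal_power I k}"

text \<open>
  The ring is the whole type \<open>'r\<close>: a principal ideal domain, not a field, whose only
  maximal ideal is \<open>\<mm>\<close>.
\<close>

locale discrete_valuation_ring =
  fixes \<mm> :: "'r::idom set"
  assumes principal: "\<And>I :: 'r set. ring_ideal I \<Longrightarrow> \<exists>a. I = module.span (*) {a}"
    and maximal: "maximal_ring_ideal \<mm>"
    and local: "\<And>I :: 'r set. maximal_ring_ideal I \<Longrightarrow> I = \<mm>"
    and not_field: "\<mm> \<noteq> {0}"

text \<open>
  Completeness is convergence of all Cauchy sequences of the \<open>\<mm>\<close>-adic topology; in a
  discrete valuation ring this topology is automatically Hausdorff.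
\<close>

locale complete_discrete_valuation_ring = discrete_valuation_ring \<mm>
  for \<mm> :: "'r::idom set" +
  assumes complete: "\<And>x :: nat \<Rightarrow> 'r.
      (\<forall>k. \<exists>N. \<forall>i\<ge>N. \<forall>j\<ge>N. x i - x j \<in> ideal_power \<mm> k) \<Longrightarrow>
      (\<exists>l. \<forall>k. \<exists>N. \<forall>i\<ge>N. x i - l \<in> ideal_power \<mm> k)"

definition residue_field :: "'r::comm_ring_1 set \<Rightarrow> 'r set set" where
  "residue_field \<mm> = UNIV // {(x, y). x - y \<in> \<mm>}"

section \<open>Normalised Haar measure\<close>

definition adic_open :: "'r::comm_ring_1 set \<Rightarrow> 'r set \<Rightarrow> bool" where
  "adic_open \<mm> U \<longleftrightarrow> (\<forall>x\<in>U. \<exists>k. \<forall>y. y - x \<in> ideal_power \<mm> k \<longrightarrow> y \<in> U)"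

text \<open>
  Regularity is not listed among the conditions: for a finite residue field the additive
  group is compact and metrisable, so every finite Borel measure on it is regular.
\<close>

definition normalised_haar_measure :: "'r::comm_ring_1 set \<Rightarrow> 'r measure \<Rightarrow> bool" where
  "normalised_haar_measure \<mm> \<mu> \<longleftrightarrow>
     space \<mu> = UNIV \<and>
     sets \<mu> = sigma_sets UNIV {U. adic_open \<mm> U} \<and>
     (\<forall>A\<in>sets \<mu>. \<forall>x. emeasure \<mu> ((\<lambda>y. x + y) ` A) = emeasure \<mu> A) \<and>
     emeasure \<mu> UNIV = 1"

section \<open>Quadratic forms\<close>

text \<open>
  A family \<open>a :: nat \<Rightarrow> nat \<Rightarrow> 'r\<close> stands for the \<open>n\<close>-ary form
  \<open>\<Sum>\<^sub>i\<^sub>\<le>\<^sub>j a\<^sub>i\<^sub>j X\<^sub>i X\<^sub>j\<close> with indices \<open>i \<le> j < n\<close>. A function \<open>x :: nat \<Rightarrow> _\<close> stands for the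
  vector \<open>(x 0, \<dots>, x (n - 1))\<close>; its values at indices \<open>\<ge> n\<close> are never used.
\<close>

definition qf :: "nat \<Rightarrow> (nat \<Rightarrow> nat \<Rightarrow> 'a::comm_ring_1) \<Rightarrow> (nat \<Rightarrow> 'a) \<Rightarrow> 'a" where
  "qf n a x = (\<Sum>i<n. \<Sum>j\<in>{i..<n}. a i j * x i * x j)"

definition qf_frac :: "nat \<Rightarrow> (nat \<Rightarrow> nat \<Rightarrow> 'r::idom) \<Rightarrow> (nat \<Rightarrow> 'r fract) \<Rightarrow> 'r fract" where
  "qf_frac n a = qf n (\<lambda>i j. Fract (a i j) 1)"

definition qf_polar :: "nat \<Rightarrow> (nat \<Rightarrow> nat \<Rightarrow> 'r::idom) \<Rightarrow>
    (nat \<Rightarrow> 'r fract) \<Rightarrow> (nat \<Rightarrow> 'r fract) \<Rightarrow> 'r fract" where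
  "qf_polar n a u w = qf_frac n a (\<lambda>i. u i + w i) - qf_frac n a u - qf_frac n a w"

definition nondegenerate :: "nat \<Rightarrow> (nat \<Rightarrow> nat \<Rightarrow> 'r::idom) \<Rightarrow> bool" where
  "nondegenerate n a \<longleftrightarrow> (\<forall>u. (\<forall>w. qf_polar n a u w = 0) \<longrightarrow> (\<forall>i<n. u i = 0))"

definition anisotropic :: "nat \<Rightarrow> (nat \<Rightarrow> nat \<Rightarrow> 'r::idom) \<Rightarrow> bool" where
  "anisotropic n a \<longleftrightarrow> (\<forall>w. qf_frac n a w = 0 \<longrightarrow> (\<forall>i<n. w i = 0))"

definition ADC :: "nat \<Rightarrow> (nat \<Rightarrow> nat \<Rightarrow> 'r::idom) \<Rightarrow> bool" where
  "ADC n a \<longleftrightarrow> (\<forall>x. (\<exists>w. Fract x 1 = qf_frac n a w) \<longrightarrow> (\<exists>w'. x = qf n a w'))"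

definition nonzero_values :: "nat \<Rightarrow> (nat \<Rightarrow> nat \<Rightarrow> 'r::idom) \<Rightarrow> 'r set" where
  "nonzero_values n a = range (qf n a) - {0}"

definition qf_density :: "'r measure \<Rightarrow> nat \<Rightarrow> (nat \<Rightarrow> nat \<Rightarrow> 'r::idom) \<Rightarrow> real" where
  "qf_density \<mu> n a = measure \<mu> (nonzero_values n a)"

end

theory Submission
  imports Defs
begin

text \<open>
  Over the fraction field \<open>K\<close> an anisotropic form is equivalent to \<open>N\<^sub>0 \<bottom> \<pi> N\<^sub>1\<close> with diagonal forms
  \<open>N\<^sub>0\<close>, \<open>N\<^sub>1\<close> whose coefficients are units. By Hensel's lemma both are anisotropic modulo \<open>\<pi>\<close>, so
  they have ranks \<open>r, s \<le> 2\<close>, and \<open>\<pi>\<^sup>2 | N\<^sub>0(z) + \<pi> N\<^sub>1(z)\<close> forces \<open>\<pi> | z\<close>. By this descent every element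
  of \<open>R\<close> represented over \<open>K\<close> is \<open>N\<^sub>0(z) + \<pi> N\<^sub>1(z)\<close> for a vector \<open>z\<close> over \<open>R\<close>, and the values form
  the union of exactly \<open>r\<close> square classes of even and \<open>s\<close> square classes of odd valuation. A square
  class meets \<open>R\<close> in measure \<open>q / (2 (q + 1))\<close> or \<open>1 / (2 (q + 1))\<close> according to this parity, so the
  density is \<open>(r q + s) / (2 (q + 1))\<close>. Conversely \<open>N\<^sub>0\<close>, \<open>N\<^sub>1\<close> can be taken to be initial segments of
  \<open>\<langle>1, -\<epsilon>\<rangle>\<close> with \<open>\<epsilon>\<close> a nonsquare unit, and the resulting form is ADC by descent.
\<close>

section \<open>Uniformizer, residues and squares\<close>

lemma dvd_diff_swap: "a dvd x - y \<longleftrightarrow> a dvd y - x" for a :: "'a::comm_ring_1"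
  by (metis dvd_minus_iff minus_diff_eq)

text \<open>\<open>\<pi>\<close> is a uniformizer and \<open>T\<close> a system of representatives of the residue field.\<close>

locale odd_complete_dvr =
  fixes \<pi> :: "'r::idom" and T :: "'r set"
  assumes pi_nz: "\<pi> \<noteq> 0"
    and pi_not_unit: "\<not> \<pi> dvd 1"
    and unit_if: "\<not> \<pi> dvd x \<Longrightarrow> x dvd 1"
    and separated: "(\<And>k. \<pi> ^ k dvd x) \<Longrightarrow> x = 0"
    and complete: "\<And>s :: nat \<Rightarrow> 'r. (\<And>k. \<exists>N. \<forall>i\<ge>N. \<forall>j\<ge>N. \<pi> ^ k dvd s i - s j) \<Longrightarrow>
      \<exists>l. \<forall>k. \<exists>N. \<forall>i\<ge>N. \<pi> ^ k dvd s i - l"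
    and finite_T: "finite T"
    and ex1_T: "\<exists>!t. t \<in> T \<and> \<pi> dvd x - t"
    and odd_card_T: "odd (card T)"
begin

section \<open>Units and valuations\<close>

lemma not_dvd_iff_unit: "\<not> \<pi> dvd x \<longleftrightarrow> x dvd 1"
  using unit_if pi_not_unit dvd_trans by blast

lemma pi_dvd_mult_iff: "\<pi> dvd x * y \<longleftrightarrow> \<pi> dvd x \<or> \<pi> dvd y"
proof
  show "\<pi> dvd x \<or> \<pi> dvd y" if "\<pi> dvd x * y"
  proof (rule ccontr)
    assume "\<not> (\<pi> dvd x \<or> \<pi> dvd y)"
    then have "x * y dvd 1 * 1" by (intro mult_dvd_mono unit_if) auto
    with that pi_not_unit dvd_trans show False by simp blast
  qed
qed auto

lemma pi_dvd_power2_iff: "\<pi> dvd x\<^sup>2 \<longleftrightarrow> \<pi> dvd x"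
  by (simp add: power2_eq_square pi_dvd_mult_iff)

lemma pi_dvd_cong: "\<pi> dvd x - y \<Longrightarrow> \<pi> dvd x \<longleftrightarrow> \<pi> dvd y"
  by (metis diff_add_cancel dvd_add_right_iff)

lemma unit_inverse:
  assumes "\<not> \<pi> dvd u"
  obtains v where "u * v = 1" "\<not> \<pi> dvd v"
proof -
  obtain v where v: "u * v = 1"
    using assms not_dvd_iff_unit by (metis dvdE)
  moreover have "\<not> \<pi> dvd v"
    using v pi_not_unit by (metis dvd_mult)
  ultimately show thesis by (rule that)
qed

lemma factor_pi:
  assumes "x \<noteq> 0"
  obtains k u where "x = u * \<pi> ^ k" "\<not> \<pi> dvd u"
proof -
  have ex: "\<exists>k. \<not> \<pi> ^ k dvd x"
    using assms separated by blast
  \<comment> \<open>The valuation of \<open>x\<close> is one less than the first exponent whose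
    power of \<pi> does not divide \<open>x\<close>; such an exponent exists because only 0 is
    divisible by every power.\<close>
  define k where "k = (LEAST k. \<not> \<pi> ^ k dvd x)"
  have k: "\<not> \<pi> ^ k dvd x"
    unfolding k_def by (rule LeastI_ex[OF ex])
  then obtain j where j: "k = Suc j"
    by (cases k) auto
  have "\<pi> ^ j dvd x"
    using not_less_Least[of j "\<lambda>k. \<not> \<pi> ^ k dvd x"] j k_def by auto
  then obtain u where u: "x = u * \<pi> ^ j"
    by (metis dvdE mult.commute)
  moreover have "\<not> \<pi> dvd u"
    using k j u by (auto simp: mult_dvd_mono)
  ultimately show thesis by (rule that)
qed

text \<open>If the exponents differed, cancelling the smaller power would leave \<pi> dividing a
  unit.\<close>

lemma factor_pi_unique:
  assumes "u * \<pi> ^ j = v * \<pi> ^ k" "\<not> \<pi> dvd u" "\<not> \<pi> dvd v"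
  shows "j = k" "u = v"
proof -
  have *: "\<not> a < b" if "x * \<pi> ^ a = y * \<pi> ^ b" "\<not> \<pi> dvd x" for x y a b
  proof
    assume "a < b"
    then have "b = a + Suc (b - a - 1)" by simp
    then have "\<pi> ^ b = \<pi> ^ a * \<pi> ^ Suc (b - a - 1)" by (metis power_add)
    with that(1) have "\<pi> ^ a * x = \<pi> ^ a * (y * \<pi> ^ Suc (b - a - 1))"
      by (simp add: algebra_simps)
    then have "x = \<pi> * (y * \<pi> ^ (b - a - 1))"
      using pi_nz by simp
    with that(2) show False by simp
  qed
  show "j = k"
    using *[OF assms(1,2)] *[OF assms(1)[symmetric] assms(3)] by simp
  with assms(1) pi_nz show "u = v" by simp
qed

section \<open>Representatives of residue classes\<close>

definition residue_rep :: "'r \<Rightarrow> 'r" where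
  "residue_rep x = (THE t. t \<in> T \<and> \<pi> dvd x - t)"

lemma residue_rep: "residue_rep x \<in> T" "\<pi> dvd x - residue_rep x"
  using theI'[OF ex1_T[of x]] unfolding residue_rep_def by auto

lemma residue_rep_eqI: "t \<in> T \<Longrightarrow> \<pi> dvd x - t \<Longrightarrow> residue_rep x = t"
  using ex1_T[of x] residue_rep[of x] by blast

lemma residue_rep_eq_iff: "residue_rep x = residue_rep y \<longleftrightarrow> \<pi> dvd x - y"
proof
  assume "residue_rep x = residue_rep y"
  then show "\<pi> dvd x - y"
    using dvd_diff[OF residue_rep(2)[of x] residue_rep(2)[of y]] by simp
next
  assume "\<pi> dvd x - y"
  then have "\<pi> dvd x - residue_rep y"
    using dvd_add[OF _ residue_rep(2)[of y], of "x - y"] by simp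
  then show "residue_rep x = residue_rep y"
    using residue_rep(1) residue_rep_eqI by blast
qed

lemma residue_rep_T: "t \<in> T \<Longrightarrow> residue_rep t = t"
  by (rule residue_rep_eqI) auto

lemma T_eq_iff: "s \<in> T \<Longrightarrow> t \<in> T \<Longrightarrow> s = t \<longleftrightarrow> \<pi> dvd s - t"
  by (metis residue_rep_T residue_rep_eq_iff)

text \<open>Translation by 1 permutes the residues; summing them all shows that \<open>q\<close> vanishes in the
  residue field, so 2 does not.\<close>

lemma two_unit: "\<not> \<pi> dvd 2"
proof
  assume two: "\<pi> dvd 2"
  have inj: "inj_on (\<lambda>t. residue_rep (t + 1)) T"
    by (rule inj_onI) (simp add: residue_rep_eq_iff T_eq_iff)
  have im: "(\<lambda>t. residue_rep (t + 1)) ` T = T"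
    by (rule endo_inj_surj[OF finite_T _ inj]) (auto intro: residue_rep)
  have "(\<Sum>t\<in>T. t) = (\<Sum>t\<in>T. residue_rep (t + 1))"
    using sum.reindex[OF inj, of "\<lambda>t. t"] im by simp
  then have "of_nat (card T) = (\<Sum>t\<in>T. (t + 1) - residue_rep (t + 1))"
    by (simp add: sum_subtractf sum.distrib)
  then have "\<pi> dvd of_nat (card T)"
    using residue_rep by (auto intro: dvd_sum)
  moreover obtain k where "card T = 2 * k + 1"
    using odd_card_T by (elim oddE)
  ultimately have "\<pi> dvd 2 * of_nat k + 1" by (simp add: add.commute)
  with two have "\<pi> dvd 1"
    by (metis dvd_add_right_iff dvd_mult2)
  with pi_not_unit show False by simp
qed

text \<open>Multiples of \<pi> qualify too, with \<open>t = 0\<close>, so the predicate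
  distinguishes square from nonsquare classes only among units.\<close>

definition residue_square :: "'r \<Rightarrow> bool" where
  "residue_square u \<longleftrightarrow> (\<exists>t. \<pi> dvd u - t\<^sup>2)"

lemma residue_square_cong:
  assumes "\<pi> dvd u - v"
  shows "residue_square u \<longleftrightarrow> residue_square v"
proof -
  have "\<pi> dvd u - t\<^sup>2 \<longleftrightarrow> \<pi> dvd v - t\<^sup>2" for t
    by (rule pi_dvd_cong) (use assms in simp)
  then show ?thesis unfolding residue_square_def by simp
qed

lemma residue_square_mult: "residue_square u \<Longrightarrow> residue_square v \<Longrightarrow> residue_square (u * v)"
proof -
  assume "residue_square u" "residue_square v"
  then obtain s t where "\<pi> dvd u - s\<^sup>2" "\<pi> dvd v - t\<^sup>2"
    unfolding residue_square_def by blast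
  then have "\<pi> dvd (u - s\<^sup>2) * v + s\<^sup>2 * (v - t\<^sup>2)"
    by (meson dvd_add dvd_mult dvd_mult2)
  then have "\<pi> dvd u * v - (s * t)\<^sup>2"
    by (simp add: algebra_simps power_mult_distrib)
  then show ?thesis unfolding residue_square_def by blast
qed

lemma residue_square_square: "residue_square (t\<^sup>2)"
  unfolding residue_square_def by (rule exI[of _ t]) simp

text \<open>Hensel's lemma for squares: the simplified Newton step
  \<open>t \<mapsto> t - (t\<^sup>2 - u) / (2 t\<^sub>0)\<close> gains one power of \<open>\<pi>\<close> each time.\<close>

lemma unit_residue_square_imp_square:
  assumes u: "\<not> \<pi> dvd u" and sq: "residue_square u"
  obtains s where "u = s\<^sup>2"
proof -
  obtain t0 where t0: "\<pi> dvd u - t0\<^sup>2"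
    using sq unfolding residue_square_def by blast
  have "\<not> \<pi> dvd t0"
    using pi_dvd_cong[OF t0] u pi_dvd_power2_iff by simp
  then obtain h where h: "2 * t0 * h = 1"
    using unit_inverse[of "2 * t0"] two_unit pi_dvd_mult_iff by metis
  define s where "s = rec_nat t0 (\<lambda>_ t. t - (t\<^sup>2 - u) * h)"
  have s0: "s 0 = t0" and sS: "s (Suc n) = s n - ((s n)\<^sup>2 - u) * h" for n
    by (simp_all add: s_def)
  have inv: "\<pi> dvd s n - t0 \<and> \<pi> ^ Suc n dvd (s n)\<^sup>2 - u" for n
  proof (induction n)
    case 0
    then show ?case using t0 by (simp add: s0 dvd_diff_swap)
  next
    case (Suc n)
    let ?e = "(s n)\<^sup>2 - u"
    have e: "\<pi> dvd ?e"
      using Suc dvd_trans[of \<pi> "\<pi> ^ Suc n"] by simp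
    have "s (Suc n) - t0 = (s n - t0) - ?e * h"
      by (simp add: sS)
    then have 1: "\<pi> dvd s (Suc n) - t0"
      using Suc e by (metis dvd_diff dvd_mult2)
    \<comment> \<open>Since \<open>2 * t0 * h = 1\<close>, the term \<open>1 - 2 * s n * h\<close>
      in the expansion of the new error equals \<open>- 2 * (s n - t0) * h\<close>. So the old error
      is multiplied by a factor divisible by \<pi>.\<close>
    have "2 * (s n - t0) * h = 2 * s n * h - 2 * t0 * h"
      by (simp add: algebra_simps)
    then have "(s (Suc n))\<^sup>2 - u = ?e * (?e * h\<^sup>2 - 2 * (s n - t0) * h)"
      using h by (simp add: sS power2_eq_square algebra_simps)
    moreover have "\<pi> dvd ?e * h\<^sup>2 - 2 * (s n - t0) * h"
      using e Suc by (meson dvd_diff dvd_mult dvd_mult2)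
    ultimately have "\<pi> ^ Suc n * \<pi> dvd (s (Suc n))\<^sup>2 - u"
      using Suc by (metis mult_dvd_mono)
    with 1 show ?case by (simp add: mult.commute)
  qed
  have step: "\<pi> ^ n dvd s (n + j) - s n" for n j
  proof (induction j)
    case (Suc j)
    have "\<pi> ^ n dvd (s (n + j))\<^sup>2 - u"
      using inv[of "n + j"] by (meson dvd_trans le_imp_power_dvd le_SucI le_add1)
    then have "\<pi> ^ n dvd (s (n + j) - s n) - ((s (n + j))\<^sup>2 - u) * h"
      using Suc by (meson dvd_diff dvd_mult2)
    then show ?case by (simp add: sS algebra_simps)
  qed simp
  have cauchy: "\<pi> ^ k dvd s i - s j" if "i \<ge> k" "j \<ge> k" for i j k
  proof -
    have "\<pi> ^ k dvd s i - s k" "\<pi> ^ k dvd s j - s k"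
      using step[of k "i - k"] step[of k "j - k"] that by simp_all
    from dvd_diff[OF this] show ?thesis by simp
  qed
  have "\<exists>l. \<forall>k. \<exists>N. \<forall>i\<ge>N. \<pi> ^ k dvd s i - l"
    by (rule complete) (use cauchy in blast)
  then obtain l where l: "\<And>k. \<exists>N. \<forall>i\<ge>N. \<pi> ^ k dvd s i - l"
    by blast
  have "\<pi> ^ k dvd l\<^sup>2 - u" for k
  proof -
    obtain N where "\<forall>i\<ge>N. \<pi> ^ k dvd s i - l" using l by blast
    \<comment> \<open>The index \<open>N + k\<close> lies past \<open>N\<close>, where
      \<open>s\<close> is close to its limit, and past \<open>k\<close>, where its square is close
      to \<open>u\<close>.\<close>
    then have a: "\<pi> ^ k dvd s (N + k) - l" by simp
    have b: "\<pi> ^ k dvd (s (N + k))\<^sup>2 - u"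
      using inv[of "N + k"] by (meson dvd_trans le_imp_power_dvd le_SucI le_add2)
    have "l\<^sup>2 - u = ((s (N + k))\<^sup>2 - u) - (s (N + k) - l) * (s (N + k) + l)"
      by (simp add: power2_eq_square algebra_simps)
    then show ?thesis using a b by (metis dvd_diff dvd_mult2)
  qed
  then have "l\<^sup>2 - u = 0" by (rule separated)
  then show thesis using that[of l] by simp
qed

section \<open>Counting square residues\<close>

definition unit_reps :: "'r set" where
  "unit_reps = {t \<in> T. \<not> \<pi> dvd t}"

definition square_reps :: "'r set" where
  "square_reps = {t \<in> unit_reps. residue_square t}"

lemma finite_reps [simp]: "finite unit_reps" "finite square_reps"
  by (simp_all add: finite_T unit_reps_def square_reps_def)

lemma residue_rep_unit_iff: "residue_rep x \<in> unit_reps \<longleftrightarrow> \<not> \<pi> dvd x"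
  using residue_rep(1) pi_dvd_cong[OF residue_rep(2)[of x]] by (simp add: unit_reps_def)

lemma residue_rep_square_iff: "residue_rep x \<in> square_reps \<longleftrightarrow> \<not> \<pi> dvd x \<and> residue_square x"
  using residue_square_cong[OF residue_rep(2)[of x]]
  by (simp add: square_reps_def residue_rep_unit_iff)

text \<open>The zero class is represented by \<open>residue_rep 0\<close>, which need not be the
  element 0 itself.\<close>

lemma T_eq_insert_unit_reps: "T = insert (residue_rep 0) unit_reps" "residue_rep 0 \<notin> unit_reps"
proof -
  have "t = residue_rep 0" if "t \<in> T" "\<pi> dvd t" for t
    using that residue_rep_eqI[of t 0] by simp
  then show "T = insert (residue_rep 0) unit_reps"
    using residue_rep(1) by (auto simp: unit_reps_def)
  show "residue_rep 0 \<notin> unit_reps"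
    by (simp add: residue_rep_unit_iff)
qed

lemma card_T_unit_reps: "card T = Suc (card unit_reps)"
  using arg_cong[OF T_eq_insert_unit_reps(1), of card] T_eq_insert_unit_reps(2)
  by (simp only: card_insert_disjoint finite_reps not_False_eq_True)

lemma residue_rep_square_image:
  "(\<lambda>t. residue_rep (t\<^sup>2)) ` unit_reps = square_reps"
proof
  show "(\<lambda>t. residue_rep (t\<^sup>2)) ` unit_reps \<subseteq> square_reps"
    by (auto simp: residue_rep_square_iff residue_square_square pi_dvd_power2_iff unit_reps_def)
  show "square_reps \<subseteq> (\<lambda>t. residue_rep (t\<^sup>2)) ` unit_reps"
  proof
    fix y assume y: "y \<in> square_reps"
    then have yT: "y \<in> T" "\<not> \<pi> dvd y"
      by (auto simp: square_reps_def unit_reps_def)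
    obtain s where s: "y = s\<^sup>2"
      using y yT unit_residue_square_imp_square by (auto simp: square_reps_def)
    \<comment> \<open>The root \<open>s\<close> need not lie in \<open>T\<close>; replacing it by
      its representative does not change its square modulo \<pi>.\<close>
    have "\<pi> dvd (s - residue_rep s) * (s + residue_rep s)"
      using residue_rep(2) by simp
    then have "\<pi> dvd y - (residue_rep s)\<^sup>2"
      by (simp add: s power2_eq_square algebra_simps)
    then have "y = residue_rep ((residue_rep s)\<^sup>2)"
      using yT residue_rep_T residue_rep_eq_iff by metis
    moreover have "residue_rep s \<in> unit_reps"
      using yT s by (simp add: residue_rep_unit_iff pi_dvd_power2_iff)
    ultimately show "y \<in> (\<lambda>t. residue_rep (t\<^sup>2)) ` unit_reps" by blast
  qed
qed

text \<open>Squaring is two-to-one on the nonzero residues.\<close>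

lemma card_unit_reps: "card unit_reps = 2 * card square_reps"
proof -
  have fib: "card {t \<in> unit_reps. residue_rep (t\<^sup>2) = y} = 2" if y: "y \<in> square_reps" for y
  proof -
    obtain s where s: "s \<in> unit_reps" "y = residue_rep (s\<^sup>2)"
      using y unfolding residue_rep_square_image[symmetric] by blast
    then have sT: "s \<in> T" "\<not> \<pi> dvd s"
      by (auto simp: unit_reps_def)
    have eq: "residue_rep (t\<^sup>2) = y \<longleftrightarrow> t = s \<or> t = residue_rep (- s)" if "t \<in> unit_reps" for t
    proof -
      have tT: "t \<in> T" using that by (simp add: unit_reps_def)
      have "residue_rep (t\<^sup>2) = y \<longleftrightarrow> \<pi> dvd t\<^sup>2 - s\<^sup>2"
        by (simp add: s residue_rep_eq_iff)
      also have "t\<^sup>2 - s\<^sup>2 = (t - s) * (t - - s)"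
        by (simp add: power2_eq_square algebra_simps)
      also have "\<pi> dvd \<dots> \<longleftrightarrow> t = s \<or> residue_rep t = residue_rep (- s)"
        unfolding pi_dvd_mult_iff residue_rep_eq_iff using T_eq_iff tT sT by blast
      finally show ?thesis using residue_rep_T[OF tT] by simp
    qed
    have "residue_rep (- s) \<in> unit_reps"
      using sT by (simp add: residue_rep_unit_iff)
    then have "{t \<in> unit_reps. residue_rep (t\<^sup>2) = y} = {s, residue_rep (- s)}"
    proof (intro equalityI subsetI)
      show "t \<in> {s, residue_rep (- s)}" if "t \<in> {t \<in> unit_reps. residue_rep (t\<^sup>2) = y}" for t
        using that eq[of t] by simp
      show "t \<in> {t \<in> unit_reps. residue_rep (t\<^sup>2) = y}" if "t \<in> {s, residue_rep (- s)}" for t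
        using that eq[of t] s(1) \<open>residue_rep (- s) \<in> unit_reps\<close> by auto
    qed
    moreover have "residue_rep (- s) \<noteq> s"
    proof
      assume "residue_rep (- s) = s"
      then have "\<pi> dvd - s - s"
        using residue_rep(2)[of "- s"] by simp
      also have "- s - s = - (2 * s)" by simp
      finally have "\<pi> dvd 2 * s" by (simp only: dvd_minus_iff)
      then show False using two_unit sT pi_dvd_mult_iff by blast
    qed
    ultimately show ?thesis by (simp add: card_insert_if)
  qed
  have "(\<Sum>t\<in>unit_reps. 1::nat) =
      (\<Sum>y\<in>square_reps. \<Sum>t\<in>{t \<in> unit_reps. residue_rep (t\<^sup>2) = y}. 1)"
    unfolding residue_rep_square_image[symmetric] by (rule sum.image_gen) simp
  also have "\<dots> = (\<Sum>y\<in>square_reps. 2)"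
    by (rule sum.cong) (simp_all add: fib)
  finally show ?thesis by simp
qed

lemma card_T: "card T = 1 + 2 * card square_reps"
  using card_T_unit_reps card_unit_reps by simp

lemma card_nonsquare_reps: "card (unit_reps - square_reps) = card square_reps"
proof -
  have "square_reps \<subseteq> unit_reps" by (auto simp: square_reps_def)
  then show ?thesis using card_unit_reps by (simp add: card_Diff_subset)
qed

lemma card_square_reps_pos: "card square_reps > 0"
proof -
  have "residue_rep (1\<^sup>2) \<in> square_reps"
    using pi_not_unit residue_square_square[of 1] by (subst residue_rep_square_iff) simp
  then show ?thesis using card_gt_0_iff finite_reps(2) by blast
qed

lemma ex_nonsquare_unit: "\<exists>\<epsilon>. \<not> \<pi> dvd \<epsilon> \<and> \<not> residue_square \<epsilon>"
proof -
  have "unit_reps - square_reps \<noteq> {}"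
    using card_nonsquare_reps card_square_reps_pos by (metis card.empty less_numeral_extra(3))
  then show ?thesis by (auto simp: unit_reps_def square_reps_def)
qed

lemma residue_square_mult_square_iff:
  assumes "\<not> \<pi> dvd t"
  shows "residue_square (u * t\<^sup>2) \<longleftrightarrow> residue_square u"
proof
  assume *: "residue_square (u * t\<^sup>2)"
  obtain v where v: "t * v = 1" using unit_inverse[OF assms] by blast
  have "u * t\<^sup>2 * v\<^sup>2 = u * (t * v)\<^sup>2" by (simp only: power_mult_distrib mult.assoc)
  then show "residue_square u"
    using residue_square_mult[OF * residue_square_square[of v]] v by (simp only: power_one mult_1_right)
qed (simp add: residue_square_mult residue_square_square)

text \<open>Multiplication by a nonsquare unit injects the nonzero squares into the equally many
  nonsquares.\<close>

lemma nonsquare_mult_nonsquare: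
  assumes u: "\<not> \<pi> dvd u" "\<not> residue_square u" and v: "\<not> \<pi> dvd v" "\<not> residue_square v"
  shows "residue_square (u * v)"
proof -
  let ?f = "\<lambda>s. residue_rep (u * s)"
  have inj: "inj_on ?f square_reps"
  proof (rule inj_onI)
    fix s t assume st: "s \<in> square_reps" "t \<in> square_reps" "?f s = ?f t"
    then have "\<pi> dvd u * (s - t)"
      by (simp add: residue_rep_eq_iff right_diff_distrib)
    with u have "\<pi> dvd s - t" using pi_dvd_mult_iff by blast
    with st show "s = t" by (simp add: T_eq_iff square_reps_def unit_reps_def)
  qed
  have "?f ` square_reps \<subseteq> unit_reps - square_reps"
  proof
    fix y assume "y \<in> ?f ` square_reps"
    then obtain s where s: "s \<in> square_reps" "y = ?f s" by blast
    then have s': "\<not> \<pi> dvd s" "residue_square s" by (auto simp: square_reps_def unit_reps_def)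
    then obtain r where r: "s = r\<^sup>2" using unit_residue_square_imp_square[of s] by blast
    then have "\<not> \<pi> dvd r" using s' pi_dvd_power2_iff by simp
    then have "\<not> residue_square (u * s)"
      using r u residue_square_mult_square_iff by simp
    then show "y \<in> unit_reps - square_reps"
      using s s' u by (simp add: residue_rep_unit_iff residue_rep_square_iff pi_dvd_mult_iff)
  qed
  then have "?f ` square_reps = unit_reps - square_reps"
    using inj card_nonsquare_reps by (intro card_subset_eq) (auto simp: card_image)
  moreover have "residue_rep v \<in> unit_reps - square_reps"
    using v by (simp add: residue_rep_unit_iff residue_rep_square_iff)
  \<comment> \<open>As the injection is onto, \<open>v\<close> is congruent to \<open>u * s\<close>
    for a square \<open>s\<close>, so \<open>u * v\<close> is congruent to
    \<open>s * u\<^sup>2\<close>.\<close>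
  ultimately obtain s where s: "s \<in> square_reps" "\<pi> dvd v - u * s"
    using residue_rep_eq_iff by (metis (no_types, lifting) imageE)
  have "\<pi> dvd u * (v - u * s)" using s by simp
  then have "\<pi> dvd u * v - s * u\<^sup>2" by (simp add: power2_eq_square algebra_simps)
  moreover have "residue_square (s * u\<^sup>2)"
    using s u by (simp add: residue_square_mult_square_iff square_reps_def)
  ultimately show ?thesis using residue_square_cong by blast
qed

text \<open>There are only two square classes of units, so \<open>u * v\<close> is a square modulo
  \<pi> in either case. Then so is the quotient \<open>u * w\<close>, with \<open>w\<close> the
  inverse of \<open>v\<close>, and Hensel's lemma makes it an exact square.\<close>

lemma same_class_units:
  assumes "\<not> \<pi> dvd u" "\<not> \<pi> dvd v" "residue_square u \<longleftrightarrow> residue_square v"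
  obtains s where "u = v * s\<^sup>2" "\<not> \<pi> dvd s"
proof -
  obtain w where w: "v * w = 1" "\<not> \<pi> dvd w" by (rule unit_inverse[OF assms(2)])
  have "residue_square (u * v)"
    using assms residue_square_mult nonsquare_mult_nonsquare by blast
  then have "residue_square (u * v * w\<^sup>2)"
    using residue_square_mult_square_iff w by blast
  also have "u * v * w\<^sup>2 = u * w * (v * w)" by (simp add: power2_eq_square)
  finally have "residue_square (u * w)" using w by simp
  moreover have uw: "\<not> \<pi> dvd u * w" using assms w pi_dvd_mult_iff by blast
  ultimately obtain s where s: "u * w = s\<^sup>2"
    using unit_residue_square_imp_square[of "u * w"] by blast
  have "u = u * (v * w)" using w by simp
  also have "\<dots> = v * s\<^sup>2" using s by (simp add: algebra_simps)
  finally have "u = v * s\<^sup>2" .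
  moreover have "\<not> \<pi> dvd s" using uw s pi_dvd_power2_iff by simp
  ultimately show thesis by (rule that)
qed

text \<open>Pigeonhole: \<open>u x\<^sup>2\<close> and \<open>w - v y\<^sup>2\<close> each take \<open>(q + 1) / 2\<close> of the \<open>q\<close> residues.\<close>

lemma binary_unit_form_universal:
  assumes u: "\<not> \<pi> dvd u" and v: "\<not> \<pi> dvd v"
  shows "\<exists>x y. \<pi> dvd w - (u * x\<^sup>2 + v * y\<^sup>2)"
proof -
  let ?Q = "(\<lambda>t. residue_rep (t\<^sup>2)) ` T"
  have "?Q = insert (residue_rep ((residue_rep 0)\<^sup>2)) square_reps"
    using arg_cong[OF T_eq_insert_unit_reps(1), of "(`) (\<lambda>t. residue_rep (t\<^sup>2))"]
    by (simp only: image_insert residue_rep_square_image)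
  moreover have "residue_rep ((residue_rep 0)\<^sup>2) \<notin> square_reps"
    using T_eq_insert_unit_reps(2) residue_rep(1)
    by (simp add: residue_rep_square_iff pi_dvd_power2_iff unit_reps_def)
  ultimately have cardQ: "card ?Q = Suc (card square_reps)" by simp
  have QT: "?Q \<subseteq> T" using residue_rep by auto
  let ?A = "(\<lambda>y. residue_rep (u * y)) ` ?Q" and ?B = "(\<lambda>y. residue_rep (w - v * y)) ` ?Q"
  have "inj_on (\<lambda>y. residue_rep (u * y)) ?Q"
  proof (rule inj_onI)
    fix y z assume yz: "y \<in> ?Q" "z \<in> ?Q" "residue_rep (u * y) = residue_rep (u * z)"
    then have "\<pi> dvd u * (y - z)" by (simp add: residue_rep_eq_iff right_diff_distrib)
    then have "\<pi> dvd y - z" using u pi_dvd_mult_iff by blast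
    moreover have "y \<in> T" "z \<in> T" using yz(1,2) QT by blast+
    ultimately show "y = z" using T_eq_iff by blast
  qed
  then have cardA: "card ?A = Suc (card square_reps)"
    using cardQ by (simp only: card_image)
  have "inj_on (\<lambda>y. residue_rep (w - v * y)) ?Q"
  proof (rule inj_onI)
    fix y z assume yz: "y \<in> ?Q" "z \<in> ?Q" "residue_rep (w - v * y) = residue_rep (w - v * z)"
    then have "\<pi> dvd v * (z - y)" by (simp add: residue_rep_eq_iff algebra_simps)
    then have "\<pi> dvd z - y" using v pi_dvd_mult_iff by blast
    moreover have "y \<in> T" "z \<in> T" using yz(1,2) QT by blast+
    ultimately show "y = z" using T_eq_iff[of z y] by blast
  qed
  then have cardB: "card ?B = Suc (card square_reps)"
    using cardQ by (simp only: card_image)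
  have "?A \<inter> ?B \<noteq> {}"
  proof
    assume "?A \<inter> ?B = {}"
    then have "card (?A \<union> ?B) = card ?A + card ?B"
      using finite_T by (intro card_Un_disjoint) auto
    moreover have "card (?A \<union> ?B) \<le> card T"
      using residue_rep by (intro card_mono finite_T) auto
    ultimately show False using cardA cardB card_T by simp
  qed
  then obtain s t where st: "residue_rep (u * residue_rep (s\<^sup>2)) = residue_rep (w - v * residue_rep (t\<^sup>2))"
    by auto
  have a: "\<pi> dvd u * (s\<^sup>2 - residue_rep (s\<^sup>2))" "\<pi> dvd v * (t\<^sup>2 - residue_rep (t\<^sup>2))"
    using residue_rep by auto
  have b: "\<pi> dvd u * residue_rep (s\<^sup>2) - (w - v * residue_rep (t\<^sup>2))"
    using st residue_rep_eq_iff by blast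
  have "w - (u * s\<^sup>2 + v * t\<^sup>2) = - (u * (s\<^sup>2 - residue_rep (s\<^sup>2)) + v * (t\<^sup>2 - residue_rep (t\<^sup>2))
    + (u * residue_rep (s\<^sup>2) - (w - v * residue_rep (t\<^sup>2))))"
    by (simp add: algebra_simps)
  then have "\<pi> dvd w - (u * s\<^sup>2 + v * t\<^sup>2)"
    using a b by (metis dvd_add dvd_minus_iff)
  then show ?thesis by blast
qed

end

section \<open>Unit forms and their descent\<close>

text \<open>The index set is a parameter so that a form can be split into blocks of coordinates
  while vectors remain functions on all indices.\<close>

definition diag_form :: "nat set \<Rightarrow> (nat \<Rightarrow> 'a::comm_ring_1) \<Rightarrow> (nat \<Rightarrow> 'a) \<Rightarrow> 'a" where
  "diag_form I c z = (\<Sum>i\<in>I. c i * (z i)\<^sup>2)"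

lemma diag_form_cong: "(\<And>i. i \<in> I \<Longrightarrow> y i = z i) \<Longrightarrow> diag_form I c y = diag_form I c z"
  unfolding diag_form_def by (rule sum.cong) auto

lemma diag_form_scale: "diag_form I c (\<lambda>i. s * z i) = s\<^sup>2 * diag_form I c z"
  unfolding diag_form_def sum_distrib_left
  by (rule sum.cong) (auto simp: power_mult_distrib algebra_simps)

lemma diag_form_zero: "(\<And>i. i \<in> I \<Longrightarrow> z i = 0) \<Longrightarrow> diag_form I c z = 0"
  unfolding diag_form_def by simp

context odd_complete_dvr begin

section \<open>Anisotropy modulo the uniformizer and unit values\<close>

definition residually_anisotropic :: "nat set \<Rightarrow> (nat \<Rightarrow> 'r) \<Rightarrow> bool" where
  "residually_anisotropic I u \<longleftrightarrow> (\<forall>z. \<pi> dvd diag_form I u z \<longrightarrow> (\<forall>i\<in>I. \<pi> dvd z i))"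

text \<open>A nontrivial zero modulo \<open>\<pi>\<close> lifts: keep all coordinates but one unit coordinate, and solve
  for that one by Hensel's lemma.\<close>

lemma anisotropic_imp_residually:
  assumes fin: "finite I" and u: "\<And>i. i \<in> I \<Longrightarrow> \<not> \<pi> dvd u i"
    and aniso: "\<And>z. diag_form I u z = 0 \<Longrightarrow> (\<forall>i\<in>I. z i = 0)"
  shows "residually_anisotropic I u"
  unfolding residually_anisotropic_def
proof (intro allI impI ballI, rule ccontr)
  fix z i assume z: "\<pi> dvd diag_form I u z" and i: "i \<in> I" and zi: "\<not> \<pi> dvd z i"
  obtain v where v: "u i * v = 1" "\<not> \<pi> dvd v" by (rule unit_inverse[OF u[OF i]])
  \<comment> \<open>\<open>c\<close> is the contribution of the other coordinates, so
    \<open>- c * v\<close>, that is \<open>- c / u i\<close>, is the value that the square of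
    coordinate \<open>i\<close> must take.\<close>
  define c where "c = diag_form (I - {i}) u z"
  have split: "diag_form I u y = u i * (y i)\<^sup>2 + diag_form (I - {i}) u y" for y
    unfolding diag_form_def using fin i by (rule sum.remove)
  have "v * diag_form I u z = (u i * v) * (z i)\<^sup>2 + c * v"
    by (simp add: split c_def algebra_simps)
  then have "v * diag_form I u z = (z i)\<^sup>2 - (- c * v)"
    using v by simp
  then have d: "\<pi> dvd (z i)\<^sup>2 - (- c * v)"
    using z by (metis dvd_mult)
  have cv: "\<not> \<pi> dvd - c * v"
    using pi_dvd_cong[OF d] zi pi_dvd_power2_iff by blast
  moreover have "residue_square (- c * v)"
    using residue_square_cong[OF d] residue_square_square by blast
  ultimately obtain s where s: "- c * v = s\<^sup>2"
    by (rule unit_residue_square_imp_square)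
  have "diag_form (I - {i}) u (z(i := s)) = c"
    unfolding c_def by (rule diag_form_cong) auto
  then have "diag_form I u (z(i := s)) = u i * s\<^sup>2 + c"
    by (simp add: split)
  also have "\<dots> = u i * (- c * v) + c" by (simp only: s)
  also have "\<dots> = c * (1 - u i * v)" by (simp add: algebra_simps)
  also have "\<dots> = 0" using v by simp
  finally have "s = 0" using aniso[of "z(i := s)"] i by auto
  with s cv show False by auto
qed

text \<open>With three coordinates, the first two unit coefficients represent \<open>- u l\<close>
  modulo \<pi>, so \<open>(x, y, 1)\<close> is a nontrivial zero modulo \<pi>.\<close>

lemma residually_anisotropic_card:
  assumes fin: "finite I" and u: "\<And>i. i \<in> I \<Longrightarrow> \<not> \<pi> dvd u i"
    and aniso: "residually_anisotropic I u"
  shows "card I \<le> 2"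
proof (rule ccontr)
  assume "\<not> card I \<le> 2"
  then have "3 \<le> card I" by simp
  then obtain J where J: "J \<subseteq> I" "card J = 3"
    by (meson obtain_subset_with_card_n)
  then obtain i j l where ijl: "J = {i, j, l}" "i \<noteq> j" "i \<noteq> l" "j \<noteq> l"
    by (auto simp: card_3_iff)
  then have mem: "i \<in> I" "j \<in> I" "l \<in> I" using J by auto
  obtain x y where xy: "\<pi> dvd - u l - (u i * x\<^sup>2 + u j * y\<^sup>2)"
    using binary_unit_form_universal[OF u[OF mem(1)] u[OF mem(2)]] by blast
  define z where "z = (\<lambda>k. if k = i then x else if k = j then y else if k = l then 1 else 0)"
  have "diag_form I u z = (\<Sum>k\<in>J. u k * (z k)\<^sup>2)"
    unfolding diag_form_def
    by (rule sum.mono_neutral_right) (use fin J ijl in \<open>auto simp: z_def\<close>)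
  also have "\<dots> = u i * x\<^sup>2 + u j * y\<^sup>2 + u l"
    using ijl by (simp add: z_def algebra_simps)
  also have "\<dots> = - (- u l - (u i * x\<^sup>2 + u j * y\<^sup>2))" by simp
  finally have "\<pi> dvd diag_form I u z"
    using xy by (simp only: dvd_minus_iff)
  then have "\<pi> dvd z l"
    using aniso mem unfolding residually_anisotropic_def by blast
  then show False using ijl pi_not_unit by (auto simp: z_def)
qed

text \<open>The two square classes of units are labelled by the truth value of
  \<open>residue_square\<close>, so counting the classes represented is taking a cardinality in
  \<open>bool set\<close>.\<close>

definition unit_classes :: "nat set \<Rightarrow> (nat \<Rightarrow> 'r) \<Rightarrow> bool set" where
  "unit_classes I u = {residue_square (diag_form I u z) | z. \<not> \<pi> dvd diag_form I u z}"

text \<open>Rank 0 has no unit value, rank 1 gives only the class of its coefficient, and rank 2 is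
  universal modulo \<pi> and gives both classes.\<close>

lemma card_unit_classes:
  assumes fin: "finite I" and u: "\<And>i. i \<in> I \<Longrightarrow> \<not> \<pi> dvd u i"
    and card: "card I \<le> 2"
  shows "card (unit_classes I u) = card I"
proof -
  consider "card I = 0" | "card I = 1" | "card I = 2" using card by linarith
  then show ?thesis
  proof cases
    case 1
    then have "I = {}" using fin by simp
    then show ?thesis by (simp add: unit_classes_def diag_form_def)
  next
    case 2
    then obtain i where i: "I = {i}" by (auto simp: card_1_singleton_iff)
    have f: "diag_form I u z = u i * (z i)\<^sup>2" for z
      by (simp add: diag_form_def i)
    have "unit_classes I u = {residue_square (u i)}"
    proof
      show "unit_classes I u \<subseteq> {residue_square (u i)}"
        by (auto simp: unit_classes_def f pi_dvd_mult_iff pi_dvd_power2_iff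
            residue_square_mult_square_iff)
      have "residue_square (u i) = residue_square (diag_form I u (\<lambda>_. 1)) \<and>
          \<not> \<pi> dvd diag_form I u (\<lambda>_. 1)"
        using u[of i] i unfolding f by simp
      then show "{residue_square (u i)} \<subseteq> unit_classes I u"
        unfolding unit_classes_def by blast
    qed
    with 2 show ?thesis by simp
  next
    case 3
    then obtain i j where ij: "I = {i, j}" "i \<noteq> j" by (auto simp: card_2_iff)
    have "b \<in> unit_classes I u" for b
    proof -
      obtain w where w: "\<not> \<pi> dvd w" "residue_square w = b"
        using ex_nonsquare_unit residue_square_square[of 1] pi_not_unit
        by (metis (full_types) power_one)
      obtain x y where xy: "\<pi> dvd w - (u i * x\<^sup>2 + u j * y\<^sup>2)"
        using binary_unit_form_universal[of "u i" "u j" w] u ij by auto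
      define z where "z = (\<lambda>k. if k = i then x else y)"
      have "diag_form I u z = u i * x\<^sup>2 + u j * y\<^sup>2"
        using ij by (simp add: diag_form_def z_def)
      with xy have d: "\<pi> dvd w - diag_form I u z" by simp
      have "\<not> \<pi> dvd diag_form I u z" "b = residue_square (diag_form I u z)"
        using pi_dvd_cong[OF d] residue_square_cong[OF d] w by simp_all
      then show ?thesis unfolding unit_classes_def by blast
    qed
    then have "unit_classes I u = UNIV" by blast
    with 3 show ?thesis by simp
  qed
qed

text \<open>For \<open>p < 2\<close> this is the part inside the ring of one of the four classes of
  nonzero elements of the fraction field modulo squares: \<open>p\<close> is the parity of the
  valuation and \<open>b\<close> the class of the unit factor.\<close>

definition square_class :: "nat \<Rightarrow> bool \<Rightarrow> 'r set" where
  "square_class p b = {w * \<pi> ^ (2 * k + p) | w k. \<not> \<pi> dvd w \<and> residue_square w = b}"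

end

text \<open>The coordinates in \<open>A\<close> belong to the unit block \<open>N\<^sub>0\<close>,
  those in \<open>B\<close> to the block \<open>N\<^sub>1\<close> that is multiplied by
  \<pi>.\<close>

locale unit_prime_form = odd_complete_dvr +
  fixes A B :: "nat set" and u :: "nat \<Rightarrow> 'a"
  assumes fin: "finite A" "finite B" and disj: "A \<inter> B = {}"
    and units: "\<And>i. i \<in> A \<union> B \<Longrightarrow> \<not> \<pi> dvd u i"
    and res_aniso: "residually_anisotropic A u" "residually_anisotropic B u"
begin

section \<open>Descent and values of the orthogonal sum\<close>

definition form :: "(nat \<Rightarrow> 'a) \<Rightarrow> 'a" where
  "form z = diag_form A u z + \<pi> * diag_form B u z"

lemma form_cong: "(\<And>i. i \<in> A \<union> B \<Longrightarrow> y i = z i) \<Longrightarrow> form y = form z"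
  unfolding form_def using diag_form_cong[of A y z u] diag_form_cong[of B y z u] by simp

lemma form_scale: "form (\<lambda>i. s * z i) = s\<^sup>2 * form z"
  by (simp add: form_def diag_form_scale algebra_simps)

lemma form_on_A: "form (\<lambda>i. if i \<in> A then z i else 0) = diag_form A u z"
  using disj unfolding form_def
  by (subst diag_form_zero[of B]) (auto intro: diag_form_cong)

lemma form_on_B: "form (\<lambda>i. if i \<in> B then z i else 0) = \<pi> * diag_form B u z"
proof -
  have "diag_form A u (\<lambda>i. if i \<in> B then z i else 0) = 0"
    by (rule diag_form_zero) (use disj in auto)
  moreover have "diag_form B u (\<lambda>i. if i \<in> B then z i else 0) = diag_form B u z"
    by (rule diag_form_cong) simp
  ultimately show ?thesis by (simp add: form_def)
qed

text \<open>Residual anisotropy makes every coordinate in \<open>A\<close> divisible by \<pi>, and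
  the form is homogeneous of degree 2.\<close>

lemma diag_form_A_pi_square:
  assumes "\<pi> dvd diag_form A u z"
  shows "\<pi>\<^sup>2 dvd diag_form A u z"
proof -
  have "\<forall>i\<in>A. \<exists>y. z i = \<pi> * y"
    using assms res_aniso(1) unfolding residually_anisotropic_def by (meson dvdE)
  then obtain y where "\<forall>i\<in>A. z i = \<pi> * y i" by metis
  then have "diag_form A u z = \<pi>\<^sup>2 * diag_form A u y"
    using diag_form_cong[of A z "\<lambda>i. \<pi> * y i" u] by (simp add: diag_form_scale)
  then show ?thesis by simp
qed

text \<open>Reducing modulo \<pi> handles the coordinates in \<open>A\<close>. The block of
  \<open>A\<close> is then divisible by \<open>\<pi>\<^sup>2\<close>, so one factor \<pi> cancels
  from the rest and the block of \<open>B\<close> is divisible by \<pi> as well.\<close>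

lemma form_dvd_step:
  assumes "\<pi>\<^sup>2 dvd form z" "i \<in> A \<union> B"
  shows "\<pi> dvd z i"
proof -
  have "\<pi> dvd form z"
    using assms(1) by (metis dvd_mult_left power2_eq_square)
  then have A: "\<pi> dvd diag_form A u z"
    unfolding form_def by (simp add: dvd_add_left_iff)
  then have "\<pi>\<^sup>2 dvd diag_form A u z" by (rule diag_form_A_pi_square)
  then have "\<pi>\<^sup>2 dvd \<pi> * diag_form B u z"
    using assms(1) unfolding form_def by (simp add: dvd_add_right_iff)
  then have "\<pi> dvd diag_form B u z"
    using pi_nz by (simp add: power2_eq_square)
  with A res_aniso assms(2) show ?thesis
    unfolding residually_anisotropic_def by blast
qed

lemma form_dvd_power:
  assumes "\<pi> ^ (2 * k) dvd form z" "i \<in> A \<union> B"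
  shows "\<pi> ^ k dvd z i"
  using assms
proof (induction k arbitrary: z)
  case (Suc k)
  have "\<pi>\<^sup>2 dvd \<pi> ^ (2 * Suc k)" by (rule le_imp_power_dvd) simp
  then have "\<pi>\<^sup>2 dvd form z" using Suc.prems(1) by (rule dvd_trans)
  then have "\<forall>j\<in>A \<union> B. \<exists>y. z j = \<pi> * y" using form_dvd_step by (meson dvdE)
  then obtain y where y: "\<forall>j\<in>A \<union> B. z j = \<pi> * y j" by metis
  then have "form z = \<pi>\<^sup>2 * form y"
    using form_cong[of z "\<lambda>i. \<pi> * y i"] by (simp add: form_scale)
  moreover have "\<pi> ^ (2 * Suc k) = \<pi>\<^sup>2 * \<pi> ^ (2 * k)"
    by (simp add: power2_eq_square)
  ultimately have "\<pi> ^ (2 * k) dvd form y"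
    using Suc.prems(1) pi_nz by (metis dvd_mult_cancel_left power_not_zero)
  then have "\<pi> ^ k dvd y i" using Suc by blast
  then show ?case using y Suc.prems(2) by simp
qed simp

text \<open>A general divisor \<open>s\<close> differs from a power of \<pi> by a unit, which
  divides everything.\<close>

lemma form_dvd_square:
  assumes "s \<noteq> 0" "s\<^sup>2 dvd form z" "i \<in> A \<union> B"
  shows "s dvd z i"
proof -
  obtain k v where s: "s = v * \<pi> ^ k" "\<not> \<pi> dvd v" by (rule factor_pi[OF assms(1)])
  obtain v' where v': "v * v' = 1" by (rule unit_inverse[OF s(2)])
  have "\<pi> ^ (2 * k) dvd s\<^sup>2"
    by (simp add: s power_mult_distrib power_mult[symmetric] mult.commute)
  then have "\<pi> ^ k dvd z i"
    using assms form_dvd_power dvd_trans by blast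
  then have "v * \<pi> ^ k dvd v * (v' * z i)" by (intro mult_dvd_mono) auto
  moreover have "v * (v' * z i) = z i" using v' by (metis mult.assoc mult_1_left)
  ultimately show ?thesis by (simp add: s)
qed

text \<open>This is ADC with denominators cleared: \<open>s\<close> is a common denominator of a
  vector over the fraction field, and it turns out to divide every coordinate of \<open>z\<close>
  that matters.\<close>

lemma form_descent:
  assumes "s \<noteq> 0" "s\<^sup>2 * x = form z"
  obtains y where "x = form y"
proof -
  have "s\<^sup>2 dvd form z" using assms(2) by (metis dvd_triv_left)
  then have "\<forall>i\<in>A \<union> B. \<exists>y. z i = s * y"
    using form_dvd_square assms(1) by (meson dvdE)
  then obtain y where "\<forall>i\<in>A \<union> B. z i = s * y i" by metis
  then have "form z = s\<^sup>2 * form y"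
    using form_cong[of z "\<lambda>i. s * y i"] by (simp add: form_scale)
  then show thesis using assms that by auto
qed

text \<open>A zero value is divisible by all powers of \<pi>, hence so is each coordinate.\<close>

lemma form_anisotropic:
  assumes "form z = 0" "i \<in> A \<union> B"
  shows "z i = 0"
proof (rule separated)
  fix k
  show "\<pi> ^ k dvd z i"
    by (rule form_dvd_power[OF _ assms(2)]) (simp add: assms(1))
qed

text \<open>Descent removes even powers of \<pi>, leaving valuation 0 or 1. In valuation 0, the unit
  is congruent to a value of the block \<open>A\<close>. In valuation 1, the block \<open>A\<close>
  is divisible by \<pi>, hence by \<open>\<pi>\<^sup>2\<close>, and cancelling \<pi> makes the unit
  congruent to a value of the block \<open>B\<close>. Conversely, scaling a vector supported on one
  block fills the whole class.\<close>

lemma form_values: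
  "range form - {0} =
     (\<Union>b\<in>unit_classes A u. square_class 0 b) \<union> (\<Union>b\<in>unit_classes B u. square_class 1 b)"
proof (intro equalityI subsetI)
  fix x assume "x \<in> range form - {0}"
  then obtain z where z: "x = form z" "x \<noteq> 0" by auto
  obtain m w where w: "x = w * \<pi> ^ m" "\<not> \<pi> dvd w" by (rule factor_pi[OF z(2)])
  define k where "k = m div 2"
  have "(\<pi> ^ k)\<^sup>2 * (w * \<pi> ^ (m mod 2)) = w * \<pi> ^ (2 * k + m mod 2)"
    by (simp add: power_add power_mult[symmetric] mult_ac)
  also have m: "2 * k + m mod 2 = m" by (simp add: k_def)
  also have "w * \<pi> ^ m = form z" using z w by simp
  finally have "(\<pi> ^ k)\<^sup>2 * (w * \<pi> ^ (m mod 2)) = form z" .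
  then obtain y where y: "w * \<pi> ^ (m mod 2) = form y"
    using form_descent[of "\<pi> ^ k"] pi_nz by (metis power_not_zero)
  have "residue_square w \<in> unit_classes (if m mod 2 = 0 then A else B) u"
  proof (cases "m mod 2 = 0")
    case True
    then have "w - diag_form A u y = \<pi> * diag_form B u y"
      using y by (simp add: form_def)
    then have d: "\<pi> dvd w - diag_form A u y" by simp
    show ?thesis
      using pi_dvd_cong[OF d] residue_square_cong[OF d] w True
      unfolding unit_classes_def by auto
  next
    case False
    then have eq: "w * \<pi> = diag_form A u y + \<pi> * diag_form B u y"
      using y by (simp add: form_def mod2_eq_if split: if_splits)
    then have "\<pi> * (w - diag_form B u y) = diag_form A u y"
      by (simp add: algebra_simps)
    moreover from this have "\<pi>\<^sup>2 dvd diag_form A u y"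
      by (metis diag_form_A_pi_square dvd_triv_left)
    ultimately have "\<pi> * \<pi> dvd \<pi> * (w - diag_form B u y)"
      by (simp add: power2_eq_square)
    then have d: "\<pi> dvd w - diag_form B u y" using pi_nz by simp
    show ?thesis
      using pi_dvd_cong[OF d] residue_square_cong[OF d] w False
      unfolding unit_classes_def by auto
  qed
  moreover have "x \<in> square_class (m mod 2) (residue_square w)"
  proof -
    have "x = w * \<pi> ^ (2 * k + m mod 2)" by (simp only: w(1) m)
    then show ?thesis using w(2) unfolding square_class_def by blast
  qed
  ultimately show "x \<in> (\<Union>b\<in>unit_classes A u. square_class 0 b) \<union> (\<Union>b\<in>unit_classes B u. square_class 1 b)"
    by (cases "m mod 2 = 0") (auto simp: mod2_eq_if split: if_splits)
next
  fix x assume "x \<in> (\<Union>b\<in>unit_classes A u. square_class 0 b) \<union> (\<Union>b\<in>unit_classes B u. square_class 1 b)"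
  then consider z where "\<not> \<pi> dvd diag_form A u z" "x \<in> square_class 0 (residue_square (diag_form A u z))"
    | z where "\<not> \<pi> dvd diag_form B u z" "x \<in> square_class 1 (residue_square (diag_form B u z))"
    unfolding unit_classes_def by blast
  then show "x \<in> range form - {0}"
  proof cases
    case (1 z)
    then obtain w k where w: "x = w * \<pi> ^ (2 * k)" "\<not> \<pi> dvd w"
        "residue_square w = residue_square (diag_form A u z)"
      unfolding square_class_def by auto
    obtain s where s: "w = diag_form A u z * s\<^sup>2"
      by (rule same_class_units[OF w(2) 1(1) w(3)])
    have "x = (\<pi> ^ k * s)\<^sup>2 * diag_form A u z"
      by (simp add: w(1) s power_mult_distrib power_mult[symmetric] mult_ac)
    also have "\<dots> = form (\<lambda>i. if i \<in> A then \<pi> ^ k * s * z i else 0)"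
      by (simp only: form_on_A diag_form_scale)
    finally show ?thesis using w pi_nz by auto
  next
    case (2 z)
    then obtain w k where w: "x = w * \<pi> ^ (2 * k + 1)" "\<not> \<pi> dvd w"
        "residue_square w = residue_square (diag_form B u z)"
      unfolding square_class_def by auto
    obtain s where s: "w = diag_form B u z * s\<^sup>2"
      by (rule same_class_units[OF w(2) 2(1) w(3)])
    have "x = \<pi> * ((\<pi> ^ k * s)\<^sup>2 * diag_form B u z)"
      by (simp add: w(1) s power_mult_distrib power_mult[symmetric] mult_ac)
    also have "\<dots> = form (\<lambda>i. if i \<in> B then \<pi> ^ k * s * z i else 0)"
      by (simp only: form_on_B diag_form_scale)
    finally show ?thesis using w pi_nz by auto
  qed
qed

end

section \<open>Measure of the square classes\<close>

text \<open>Invariance is recorded only for cosets of the ideals generated by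
  \<open>\<pi> ^ k\<close>, from which the square classes are built by countable unions.\<close>

locale odd_complete_dvr_haar = odd_complete_dvr +
  fixes \<mu> :: "'a measure"
  assumes space_mu: "space \<mu> = UNIV" and total_mu: "emeasure \<mu> UNIV = 1"
    and coset_sets: "{y. \<pi> ^ k dvd y - x} \<in> sets \<mu>"
    and coset_invariant: "measure \<mu> {y. \<pi> ^ k dvd y - x} = measure \<mu> {y. \<pi> ^ k dvd y - 0}"
begin

sublocale finite_measure \<mu>
  by standard (simp add: space_mu total_mu)

definition coset :: "nat \<Rightarrow> 'a \<Rightarrow> 'a set" where
  "coset k x = {y. \<pi> ^ k dvd y - x}"

lemma coset_in_sets [simp]: "coset k x \<in> sets \<mu>"
  unfolding coset_def by (rule coset_sets)

lemma measure_coset: "measure \<mu> (coset k x) = measure \<mu> (coset k 0)"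
  unfolding coset_def by (rule coset_invariant)

lemma dvd_power_Suc_iff: "\<pi> ^ Suc k dvd \<pi> ^ k * x \<longleftrightarrow> \<pi> dvd x"
  by (simp only: power_Suc2 dvd_mult_cancel_left) (simp add: pi_nz)

lemma coset_disjoint:
  assumes "s \<in> T" "t \<in> T" "s \<noteq> t"
  shows "coset (Suc k) (x + \<pi> ^ k * s) \<inter> coset (Suc k) (x + \<pi> ^ k * t) = {}"
proof (rule ccontr)
  assume "\<not> ?thesis"
  then obtain y where "\<pi> ^ Suc k dvd y - (x + \<pi> ^ k * s)" "\<pi> ^ Suc k dvd y - (x + \<pi> ^ k * t)"
    unfolding coset_def by auto
  from dvd_diff[OF this] have "\<pi> ^ Suc k dvd \<pi> ^ k * (t - s)"
    by (simp add: algebra_simps)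
  then have "\<pi> dvd t - s" by (simp only: dvd_power_Suc_iff)
  with assms show False using T_eq_iff by blast
qed

text \<open>Fixing the next digit in the \<pi>-adic expansion of \<open>y - x\<close> selects one of
  the smaller cosets.\<close>

lemma coset_split: "coset k x = (\<Union>t\<in>T. coset (Suc k) (x + \<pi> ^ k * t))"
proof (intro equalityI subsetI)
  fix y assume "y \<in> coset k x"
  then obtain c where c: "y - x = \<pi> ^ k * c" unfolding coset_def by auto
  have "y - (x + \<pi> ^ k * residue_rep c) = (y - x) - \<pi> ^ k * residue_rep c" by simp
  also have "\<dots> = \<pi> ^ k * (c - residue_rep c)" by (simp add: c algebra_simps)
  finally have "\<pi> ^ Suc k dvd y - (x + \<pi> ^ k * residue_rep c)"
    using residue_rep(2) by (simp only: dvd_power_Suc_iff)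
  then show "y \<in> (\<Union>t\<in>T. coset (Suc k) (x + \<pi> ^ k * t))"
    using residue_rep(1) unfolding coset_def by blast
next
  fix y assume "y \<in> (\<Union>t\<in>T. coset (Suc k) (x + \<pi> ^ k * t))"
  then obtain t where t: "\<pi> ^ Suc k dvd y - (x + \<pi> ^ k * t)" unfolding coset_def by auto
  have "\<pi> ^ k dvd \<pi> ^ Suc k" by (rule le_imp_power_dvd) simp
  then have "\<pi> ^ k dvd y - (x + \<pi> ^ k * t)" using t by (rule dvd_trans)
  then have "\<pi> ^ k dvd (y - (x + \<pi> ^ k * t)) + \<pi> ^ k * t" by (rule dvd_add) simp
  also have "(y - (x + \<pi> ^ k * t)) + \<pi> ^ k * t = y - x" by simp
  finally show "y \<in> coset k x" unfolding coset_def by simp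
qed

text \<open>Taking \<open>S = T\<close> gives the recursion for the measure of a coset; taking for
  \<open>S\<close> the representatives of one square class measures that class in a fixed
  valuation.\<close>

lemma measure_coset_Union:
  assumes "S \<subseteq> T"
  shows "measure \<mu> (\<Union>t\<in>S. coset (Suc k) (x + \<pi> ^ k * t)) = card S * measure \<mu> (coset (Suc k) 0)"
proof -
  have "measure \<mu> (\<Union>t\<in>S. coset (Suc k) (x + \<pi> ^ k * t)) =
      (\<Sum>t\<in>S. measure \<mu> (coset (Suc k) (x + \<pi> ^ k * t)))"
  proof (rule finite_measure_finite_Union)
    show "finite S" using assms finite_T by (rule finite_subset)
    show "disjoint_family_on (\<lambda>t. coset (Suc k) (x + \<pi> ^ k * t)) S"
      unfolding disjoint_family_on_def
      by (intro ballI impI coset_disjoint) (use assms in auto)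
  qed auto
  also have "\<dots> = (\<Sum>t\<in>S. measure \<mu> (coset (Suc k) 0))"
    by (rule sum.cong[OF refl]) (rule measure_coset)
  finally show ?thesis by simp
qed

lemma card_T_pos: "0 < card T"
  by (rule odd_pos[OF odd_card_T])

lemma measure_coset_0: "measure \<mu> (coset k 0) = 1 / real (card T) ^ k"
proof (induction k)
  case 0
  then show ?case using total_mu by (simp add: coset_def measure_def)
next
  case (Suc k)
  have "measure \<mu> (coset k 0) = card T * measure \<mu> (coset (Suc k) 0)"
    using measure_coset_Union[OF order_refl, of k 0] coset_split[of k 0] by simp
  then show ?case using Suc card_T_pos by (simp add: field_simps)
qed

section \<open>Elements of given valuation and square class\<close>

definition sphere_class :: "nat \<Rightarrow> bool \<Rightarrow> 'a set" where
  "sphere_class k b = {w * \<pi> ^ k | w. \<not> \<pi> dvd w \<and> residue_square w = b}"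

definition class_reps :: "bool \<Rightarrow> 'a set" where
  "class_reps b = {t \<in> T. \<not> \<pi> dvd t \<and> residue_square t = b}"

lemma card_class_reps: "card (class_reps b) = card square_reps"
proof (cases b)
  case True
  then have "class_reps b = square_reps"
    by (auto simp: class_reps_def square_reps_def unit_reps_def)
  then show ?thesis by simp
next
  case False
  then have "class_reps b = unit_reps - square_reps"
    by (auto simp: class_reps_def square_reps_def unit_reps_def)
  then show ?thesis by (simp add: card_nonsquare_reps)
qed

text \<open>The class of the unit factor depends only on its residue, so membership is decided
  modulo \<open>\<pi> ^ Suc k\<close>. The summand \<open>0\<close> matches the shape of
  \<open>measure_coset_Union\<close>.\<close>

lemma sphere_class_eq: "sphere_class k b = (\<Union>t\<in>class_reps b. coset (Suc k) (0 + \<pi> ^ k * t))"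
proof (intro equalityI subsetI)
  fix y assume "y \<in> sphere_class k b"
  then obtain w where w: "y = w * \<pi> ^ k" "\<not> \<pi> dvd w" "residue_square w = b"
    unfolding sphere_class_def by auto
  have "residue_rep w \<in> class_reps b"
    using residue_rep w pi_dvd_cong[OF residue_rep(2)[of w]] residue_square_cong[OF residue_rep(2)[of w]]
    unfolding class_reps_def by simp
  moreover have "y - (0 + \<pi> ^ k * residue_rep w) = \<pi> ^ k * (w - residue_rep w)"
    by (simp add: w(1) algebra_simps)
  then have "y \<in> coset (Suc k) (0 + \<pi> ^ k * residue_rep w)"
    using residue_rep(2) dvd_power_Suc_iff unfolding coset_def by simp
  ultimately show "y \<in> (\<Union>t\<in>class_reps b. coset (Suc k) (0 + \<pi> ^ k * t))" by blast
next
  fix y assume "y \<in> (\<Union>t\<in>class_reps b. coset (Suc k) (0 + \<pi> ^ k * t))"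
  then obtain t where t: "\<not> \<pi> dvd t" "residue_square t = b" "\<pi> ^ Suc k dvd y - \<pi> ^ k * t"
    unfolding coset_def class_reps_def by auto
  then obtain c where c: "y - \<pi> ^ k * t = \<pi> ^ Suc k * c" by auto
  have "y = (t + \<pi> * c) * \<pi> ^ k"
    using c by (simp add: algebra_simps)
  moreover have d: "\<pi> dvd (t + \<pi> * c) - t" by simp
  have "\<not> \<pi> dvd t + \<pi> * c" "residue_square (t + \<pi> * c) = b"
    using pi_dvd_cong[OF d] residue_square_cong[OF d] t by simp_all
  ultimately show "y \<in> sphere_class k b" unfolding sphere_class_def by blast
qed

lemma sphere_class_sets: "sphere_class k b \<in> sets \<mu>"
proof -
  have "finite (class_reps b)" using finite_T by (simp add: class_reps_def)
  then show ?thesis unfolding sphere_class_eq by (intro sets.finite_UN) auto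
qed

lemma measure_sphere_class:
  "measure \<mu> (sphere_class k b) = real (card square_reps) / real (card T) ^ Suc k"
proof -
  have "class_reps b \<subseteq> T" by (auto simp: class_reps_def)
  then show ?thesis
    unfolding sphere_class_eq measure_coset_Union[OF \<open>class_reps b \<subseteq> T\<close>] measure_coset_0
    by (simp add: card_class_reps)
qed

lemma square_class_eq: "square_class p b = (\<Union>k. sphere_class (2 * k + p) b)"
proof (rule set_eqI)
  show "x \<in> square_class p b \<longleftrightarrow> x \<in> (\<Union>k. sphere_class (2 * k + p) b)" for x
    by (simp only: square_class_def sphere_class_def UN_iff mem_Collect_eq) blast
qed

lemma square_class_sets: "square_class p b \<in> sets \<mu>"
  unfolding square_class_eq using sphere_class_sets by (intro sets.countable_UN) auto

text \<open>The valuation and the unit factor are unique, and \<open>p < 2\<close> makes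
  \<open>p\<close> the parity of the valuation.\<close>

lemma square_class_disjoint:
  assumes "x \<in> square_class p b" "x \<in> square_class p' b'" "p < 2" "p' < 2"
  shows "p = p' \<and> b = b'"
proof -
  obtain w k where w: "x = w * \<pi> ^ (2 * k + p)" "\<not> \<pi> dvd w" "residue_square w = b"
    using assms(1) unfolding square_class_def by auto
  obtain w' k' where w': "x = w' * \<pi> ^ (2 * k' + p')" "\<not> \<pi> dvd w'" "residue_square w' = b'"
    using assms(2) unfolding square_class_def by auto
  have "w * \<pi> ^ (2 * k + p) = w' * \<pi> ^ (2 * k' + p')" using w w' by simp
  note eq = factor_pi_unique[OF this w(2) w'(2)]
  have "p = p'" using eq(1) assms(3,4) by presburger
  then show ?thesis using eq w w' by simp
qed

text \<open>Valuation \<open>2 * k + p\<close> contributes \<open>(q - 1) / 2\<close> cosets of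
  measure \<open>1 / q ^ (2 * k + p + 1)\<close>, where \<open>q = card T\<close>. The sum over
  \<open>k\<close> is a geometric series of ratio \<open>1 / q\<^sup>2\<close>.\<close>

lemma measure_square_class:
  "measure \<mu> (square_class p b) =
     real (card T) / (real (card T) ^ p * (2 * (real (card T) + 1)))"
proof -
  let ?q = "real (card T)"
  have q: "?q = 1 + 2 * real (card square_reps)" using card_T by simp
  then have q1: "?q > 1" using card_square_reps_pos by simp
  have "(\<lambda>k. measure \<mu> (sphere_class (2 * k + p) b)) sums measure \<mu> (square_class p b)"
    unfolding square_class_eq
  proof (rule finite_measure_UNION)
    show "range (\<lambda>k. sphere_class (2 * k + p) b) \<subseteq> sets \<mu>" using sphere_class_sets by auto
    show "disjoint_family (\<lambda>k. sphere_class (2 * k + p) b)"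
      unfolding disjoint_family_on_def
    proof (intro ballI impI, rule ccontr)
      fix k l :: nat
      assume "k \<noteq> l" "sphere_class (2 * k + p) b \<inter> sphere_class (2 * l + p) b \<noteq> {}"
      then obtain w v where "w * \<pi> ^ (2 * k + p) = v * \<pi> ^ (2 * l + p)" "\<not> \<pi> dvd w" "\<not> \<pi> dvd v"
        unfolding sphere_class_def by auto
      from factor_pi_unique(1)[OF this] \<open>k \<noteq> l\<close> show False by simp
    qed
  qed
  moreover have "measure \<mu> (sphere_class (2 * k + p) b) =
      real (card square_reps) / ?q ^ Suc p * (1 / ?q\<^sup>2) ^ k" for k
  proof -
    have "Suc (2 * k + p) = Suc p + 2 * k" by simp
    then have "?q ^ Suc (2 * k + p) = ?q ^ Suc p * (?q\<^sup>2) ^ k"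
      by (simp only: power_add power_mult)
    then show ?thesis unfolding measure_sphere_class by (simp only: power_divide power_one) simp
  qed
  moreover have "norm (1 / ?q\<^sup>2) < 1"
    using q1 by (simp add: power2_eq_square less_1_mult)
  then have "(\<lambda>k. real (card square_reps) / ?q ^ Suc p * (1 / ?q\<^sup>2) ^ k) sums
      (real (card square_reps) / ?q ^ Suc p * (1 / (1 - 1 / ?q\<^sup>2)))"
    by (intro sums_mult geometric_sums)
  ultimately have "measure \<mu> (square_class p b) =
      real (card square_reps) / ?q ^ Suc p * (1 / (1 - 1 / ?q\<^sup>2))"
    using sums_unique2 by simp
  also have "real (card square_reps) = (?q - 1) / 2" using q by simp
  also have "(?q - 1) / 2 / ?q ^ Suc p * (1 / (1 - 1 / ?q\<^sup>2)) = ?q / (?q ^ p * (2 * (?q + 1)))"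
  proof -
    have "1 - 1 / ?q\<^sup>2 = (?q - 1) * (?q + 1) / ?q\<^sup>2"
      using q1 by (simp add: field_simps power2_eq_square)
    then show ?thesis using q1 by (simp add: divide_simps) (simp add: power2_eq_square)
  qed
  finally show ?thesis .
qed

end

locale unit_prime_form_haar = unit_prime_form + odd_complete_dvr_haar
begin

text \<open>By \<open>form_values\<close> the set is a disjoint union of square classes. Residual
  anisotropy bounds both ranks by 2, so each block contributes as many classes as it has
  coordinates.\<close>

lemma measure_form_values:
  "measure \<mu> (range form - {0}) =
     (real (card A) * real (card T) + real (card B)) / (2 * (real (card T) + 1))"
proof -
  let ?q = "real (card T)"
  let ?C = "\<lambda>p I. \<Union>b\<in>unit_classes I u. square_class p b"
  have U: "measure \<mu> (?C p I) = card (unit_classes I u) * (?q / (?q ^ p * (2 * (?q + 1))))"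
    if "p < 2" for p I
  proof -
    have "measure \<mu> (?C p I) = (\<Sum>b\<in>unit_classes I u. measure \<mu> (square_class p b))"
    proof (rule finite_measure_finite_Union)
      show "disjoint_family_on (square_class p) (unit_classes I u)"
        using square_class_disjoint that unfolding disjoint_family_on_def by blast
    qed (use square_class_sets in auto)
    then show ?thesis by (simp only: measure_square_class sum_constant)
  qed
  have S: "?C p I \<in> sets \<mu>" for p I
    using square_class_sets by (intro sets.finite_UN) auto
  have "?C 0 A \<inter> ?C 1 B = {}"
    using square_class_disjoint[of _ 0 _ 1] by auto
  then have "measure \<mu> (range form - {0}) = measure \<mu> (?C 0 A) + measure \<mu> (?C 1 B)"
    unfolding form_values by (intro finite_measure_Union S)
  also have "measure \<mu> (?C 0 A) = card A * (?q / (2 * (?q + 1)))"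
    using U[of 0 A] card_unit_classes[of A u] residually_anisotropic_card[of A u] fin units res_aniso
    by simp
  also have "measure \<mu> (?C 1 B) = card B * (1 / (2 * (?q + 1)))"
    using U[of 1 B] card_unit_classes[of B u] residually_anisotropic_card[of B u] fin units res_aniso
      card_T_pos by simp
  finally show ?thesis by (simp add: add_divide_distrib)
qed

end

section \<open>Diagonalisation over a field\<close>

lemma qf_Suc:
  "qf (Suc n) a x = qf n a x + (\<Sum>i<n. a i n * x i) * x n + a n n * (x n)\<^sup>2"
proof -
  have "(\<Sum>j\<in>{i..<Suc n}. a i j * x i * x j) = (\<Sum>j\<in>{i..<n}. a i j * x i * x j) + a i n * x i * x n"
    if "i < n" for i
    using that by simp
  then have "(\<Sum>i<n. \<Sum>j\<in>{i..<Suc n}. a i j * x i * x j) =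
      (\<Sum>i<n. (\<Sum>j\<in>{i..<n}. a i j * x i * x j) + a i n * x i * x n)"
    by (intro sum.cong) auto
  then show ?thesis
    by (simp add: qf_def sum.distrib sum_distrib_right power2_eq_square mult.assoc)
qed

lemma qf_cong: "(\<And>i. i < n \<Longrightarrow> x i = y i) \<Longrightarrow> qf n a x = qf n a y"
  unfolding qf_def by (intro sum.cong) auto

lemma qf_zero: "(\<And>i. i < n \<Longrightarrow> x i = 0) \<Longrightarrow> qf n a x = 0"
  unfolding qf_def by (intro sum.neutral ballI) auto

lemma qf_scale: "qf n a (\<lambda>i. s * x i) = s\<^sup>2 * qf n a x"
  unfolding qf_def sum_distrib_left
  by (intro sum.cong refl) (simp add: power2_eq_square algebra_simps)

lemma qf_linear: "qf n (\<lambda>i j. a i j - c * b i j) x = qf n a x - c * qf n b x"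
  unfolding qf_def sum_distrib_left sum_subtractf[symmetric]
  by (intro sum.cong refl) (simp add: algebra_simps)

lemma qf_diagonal: "qf n (\<lambda>i j. if i = j then d i else 0) x = diag_form {..<n} d x"
proof (induction n)
  case 0
  then show ?case by (simp add: qf_def diag_form_def)
next
  case (Suc n)
  have "(\<Sum>i<n. (if i = n then d i else 0) * x i) = 0"
    by (rule sum.neutral) auto
  then show ?case using Suc by (simp add: qf_Suc diag_form_def)
qed

text \<open>Only pairs \<open>i \<le> j\<close> occur in \<open>qf\<close>, hence the factor 2 off
  the diagonal. As a coefficient family, the square can be subtracted from another form by
  \<open>qf_linear\<close>.\<close>

lemma square_of_linear_form:
  "(\<Sum>i<n. l i * x i)\<^sup>2 = qf n (\<lambda>i j. if i = j then (l i)\<^sup>2 else 2 * l i * l j) x"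
proof (induction n)
  case 0
  then show ?case by (simp add: qf_def)
next
  case (Suc n)
  have "(\<Sum>i<n. (if i = n then (l i)\<^sup>2 else 2 * l i * l n) * x i) = (\<Sum>i<n. 2 * l n * (l i * x i))"
    by (rule sum.cong) (auto simp: algebra_simps)
  also have "\<dots> = 2 * l n * (\<Sum>i<n. l i * x i)" by (simp add: sum_distrib_left)
  finally show ?case
    using Suc by (simp add: qf_Suc power2_sum power_mult_distrib algebra_simps)
qed

lemma diag_form_Suc: "diag_form {..<Suc n} c x = diag_form {..<n} c x + c n * (x n)\<^sup>2"
  by (simp add: diag_form_def)

text \<open>With \<open>L\<close> the linear form multiplying \<open>x n\<close>, the completed
  square is \<open>a n n * (x n)\<^sup>2 + L * x n + L\<^sup>2 / (4 * a n n)\<close>;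
  \<open>b\<close> absorbs the last term with opposite sign.\<close>

lemma complete_square:
  fixes a :: "nat \<Rightarrow> nat \<Rightarrow> 'a::field"
  assumes two: "(2::'a) \<noteq> 0" and d: "a n n \<noteq> 0"
  defines "b \<equiv> \<lambda>i j. a i j - 1 / (4 * a n n) * (if i = j then (a i n)\<^sup>2 else 2 * a i n * a j n)"
  shows "qf (Suc n) a x = qf n b x + a n n * (x n + (\<Sum>i<n. a i n * x i) / (2 * a n n))\<^sup>2"
proof -
  have four: "(4::'a) \<noteq> 0" using two by (metis mult_2 mult_eq_0_iff numeral_Bit0)
  define L where "L = (\<Sum>i<n. a i n * x i)"
  have "qf n b x = qf n a x - 1 / (4 * a n n) * L\<^sup>2"
    unfolding b_def qf_linear L_def square_of_linear_form ..
  moreover have "a n n * (x n + L / (2 * a n n))\<^sup>2 =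
      a n n * (x n)\<^sup>2 + L * x n + 1 / (4 * a n n) * L\<^sup>2"
    using two four d by (simp add: field_simps power2_eq_square)
  ultimately show ?thesis unfolding qf_Suc L_def[symmetric] by simp
qed

text \<open>Anisotropy makes the value \<open>a n n\<close> at the last unit vector nonzero, so the
  square in the last variable can always be completed. Instead of an explicit change of basis, the
  induction carries equality of value sets together with anisotropy.\<close>

lemma anisotropic_diagonalisation:
  fixes a :: "nat \<Rightarrow> nat \<Rightarrow> 'a::field"
  assumes two: "(2::'a) \<noteq> 0" and aniso: "\<And>x. qf n a x = 0 \<Longrightarrow> (\<forall>i<n. x i = 0)"
  shows "\<exists>c. range (qf n a) = range (diag_form {..<n} c) \<and>
    (\<forall>x. diag_form {..<n} c x = 0 \<longrightarrow> (\<forall>i<n. x i = 0))"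
  using aniso
proof (induction n arbitrary: a)
  case 0
  have "qf 0 a = (\<lambda>_. 0)" "diag_form {..<0} c = (\<lambda>_. 0)" for c :: "nat \<Rightarrow> 'a"
    by (auto simp: qf_def diag_form_def)
  then show ?case by simp
next
  case (Suc n)
  define e :: "nat \<Rightarrow> 'a" where "e = (\<lambda>i. if i = n then 1 else 0)"
  have "qf (Suc n) a e = a n n"
    using qf_zero[of n e a] by (simp add: qf_Suc e_def)
  moreover have "e n \<noteq> 0" by (simp add: e_def)
  ultimately have d: "a n n \<noteq> 0"
    using Suc.prems[of e] by auto
  define b where "b = (\<lambda>i j. a i j - 1 / (4 * a n n) * (if i = j then (a i n)\<^sup>2 else 2 * a i n * a j n))"
  define M where "M x = (\<Sum>i<n. a i n * x i) / (2 * a n n)" for x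
  have sq: "qf (Suc n) a x = qf n b x + a n n * (x n + M x)\<^sup>2" for x
    unfolding b_def M_def by (rule complete_square[where a = a and n = n, OF two d])
  \<comment> \<open>\<open>M x\<close> does not involve coordinate \<open>n\<close>, so that
    coordinate can be chosen to give the completed square any prescribed base
    \<open>t\<close>.\<close>
  have upd: "qf (Suc n) a (x(n := t - M x)) = qf n b x + a n n * t\<^sup>2" for x t
  proof -
    have "qf n b (x(n := t - M x)) = qf n b x" by (rule qf_cong) simp
    moreover have "M (x(n := t - M x)) = M x" unfolding M_def by simp
    ultimately show ?thesis by (simp add: sq)
  qed
  have "\<forall>i<n. x i = 0" if "qf n b x = 0" for x
  proof -
    have "qf (Suc n) a (x(n := 0 - M x)) = 0" unfolding upd using that by simp
    then have "\<forall>i<Suc n. (x(n := 0 - M x)) i = 0" by (rule Suc.prems)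
    then show ?thesis by (metis fun_upd_other less_SucI less_irrefl)
  qed
  then obtain c where c: "range (qf n b) = range (diag_form {..<n} c)"
      "\<And>x. diag_form {..<n} c x = 0 \<Longrightarrow> (\<forall>i<n. x i = 0)"
    using Suc.IH[of b] by blast
  define c' where "c' = c(n := a n n)"
  have c': "diag_form {..<Suc n} c' z = diag_form {..<n} c z + a n n * (z n)\<^sup>2" for z
  proof -
    have "diag_form {..<n} c' z = diag_form {..<n} c z"
      unfolding diag_form_def c'_def by (rule sum.cong) auto
    then show ?thesis by (simp add: diag_form_Suc c'_def)
  qed
  have "range (qf (Suc n) a) = range (diag_form {..<Suc n} c')"
  proof (intro equalityI subsetI)
    fix y assume "y \<in> range (qf (Suc n) a)"
    then obtain x where x: "y = qf (Suc n) a x" by blast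
    have "qf n b x \<in> range (diag_form {..<n} c)" using c(1) by blast
    then obtain z where z: "qf n b x = diag_form {..<n} c z" by blast
    have "diag_form {..<n} c (z(n := x n + M x)) = diag_form {..<n} c z"
      by (rule diag_form_cong) auto
    then have "y = diag_form {..<Suc n} c' (z(n := x n + M x))"
      by (simp add: c' x sq z)
    then show "y \<in> range (diag_form {..<Suc n} c')" by blast
  next
    fix y assume "y \<in> range (diag_form {..<Suc n} c')"
    then obtain z where z: "y = diag_form {..<Suc n} c' z" by blast
    have "diag_form {..<n} c z \<in> range (qf n b)" using c(1) by blast
    then obtain x where "diag_form {..<n} c z = qf n b x" by blast
    then have "y = qf (Suc n) a (x(n := z n - M x))" by (simp only: z c' upd)
    then show "y \<in> range (qf (Suc n) a)" by blast
  qed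
  \<comment> \<open>The value of the first \<open>n\<close> terms at \<open>z\<close> is realised by
    some \<open>x\<close> under \<open>b\<close>. Anisotropy of \<open>a\<close> makes
    \<open>x\<close> vanish, so these terms at \<open>z\<close> sum to 0 and the induction
    hypothesis applies.\<close>
  moreover have "\<forall>i<Suc n. z i = 0" if z: "diag_form {..<Suc n} c' z = 0" for z
  proof -
    have "diag_form {..<n} c z \<in> range (qf n b)" using c(1) by blast
    then obtain x where x: "diag_form {..<n} c z = qf n b x" by blast
    have "qf (Suc n) a (x(n := z n - M x)) = 0" using z by (simp only: c' upd x)
    then have x0: "\<forall>i<Suc n. (x(n := z n - M x)) i = 0" by (rule Suc.prems)
    have xn: "x i = 0" if "i < n" for i using x0[rule_format, of i] that by simp
    then have "M x = 0" unfolding M_def by simp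
    moreover have "z n - M x = 0" using x0[rule_format, of n] by simp
    ultimately have "z n = 0" by simp
    moreover have "diag_form {..<n} c z = 0" unfolding x using xn by (rule qf_zero)
    then have "\<forall>i<n. z i = 0" by (rule c(2))
    ultimately show ?thesis by (auto simp: less_Suc_eq)
  qed
  ultimately show ?case by blast
qed

section \<open>Clearing denominators in the fraction field\<close>

lemma to_fract_power: "to_fract (x ^ k) = to_fract x ^ k"
  by (induction k) simp_all

lemma qf_frac_to_fract: "qf_frac n a (\<lambda>i. to_fract (z i)) = to_fract (qf n a z)"
  by (simp add: qf_frac_def qf_def to_fract_def[symmetric])

lemma common_denominator:
  fixes w :: "nat \<Rightarrow> 'r::idom fract"
  shows "\<exists>s z. s \<noteq> 0 \<and> (\<forall>i<n. to_fract s * w i = to_fract (z i))"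
proof (induction n)
  case 0
  show ?case by (intro exI[of _ 1]) simp
next
  case (Suc n)
  then obtain s z where s: "s \<noteq> 0" "\<forall>i<n. to_fract s * w i = to_fract (z i)" by blast
  obtain p r where pr: "w n = to_fract p / to_fract r" "r \<noteq> 0"
    by (cases "w n") (auto simp: Fract_conv_to_fract)
  have "to_fract (s * r) * w i = to_fract (if i = n then s * p else r * z i)" if "i < Suc n" for i
  proof (cases "i = n")
    case True
    then show ?thesis using pr by simp
  next
    case False
    with that s have "to_fract s * w i = to_fract (z i)" by simp
    then have "to_fract r * (to_fract s * w i) = to_fract r * to_fract (z i)" by simp
    with False show ?thesis by (simp add: mult_ac)
  qed
  moreover have "s * r \<noteq> 0" using s pr by simp
  ultimately show ?case by (intro exI[of _ "s * r"] exI[of _ "\<lambda>i. if i = n then s * p else r * z i"]) simp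
qed

text \<open>The polar form of \<open>u\<close> with itself is twice the value at \<open>u\<close>,
  so a vector in the radical is isotropic.\<close>

lemma anisotropic_imp_nondegenerate:
  fixes a :: "nat \<Rightarrow> nat \<Rightarrow> 'r::idom"
  assumes "(2::'r fract) \<noteq> 0" "anisotropic n a"
  shows "nondegenerate n a"
  unfolding nondegenerate_def
proof (intro allI impI)
  fix u i assume u: "\<forall>w. qf_polar n a u w = 0" and i: "i < n"
  have "(\<lambda>i. u i + u i) = (\<lambda>i. 2 * u i)" by (simp only: mult_2)
  then have "qf_polar n a u u = 2 * qf_frac n a u"
    unfolding qf_polar_def qf_frac_def by (simp add: qf_scale power2_eq_square)
  with u assms(1) have "qf_frac n a u = 0" by simp
  with assms(2) i show "u i = 0" unfolding anisotropic_def by blast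
qed

section \<open>Densities of anisotropic ADC forms\<close>

context odd_complete_dvr begin

lemma two_fract_nz: "(2::'r fract) \<noteq> 0"
proof -
  have "(2::'r fract) = to_fract (1 + 1)" by (simp only: to_fract_add to_fract_1) simp
  moreover have "(1 + 1 :: 'r) \<noteq> 0" using two_unit by (metis dvd_0_right one_add_one)
  ultimately show ?thesis by (simp only: to_fract_eq_0_iff not_False_eq_True)
qed

text \<open>A fraction \<open>p / r\<close> equals \<open>p * r / r\<^sup>2\<close>; the even part
  of the power of \<pi> in \<open>p * r\<close> is also moved into the square.\<close>

lemma fract_square_class:
  fixes c :: "'r fract"
  assumes "c \<noteq> 0"
  shows "\<exists>t v. \<exists>e<2. t \<noteq> 0 \<and> \<not> \<pi> dvd v \<and> c = to_fract (v * \<pi> ^ e) * t\<^sup>2"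
proof -
  obtain p r where pr: "c = to_fract p / to_fract r" "r \<noteq> 0"
    by (cases c) (auto simp: Fract_conv_to_fract)
  then have "p * r \<noteq> 0" using assms by auto
  then obtain m v where v: "p * r = v * \<pi> ^ m" "\<not> \<pi> dvd v" by (rule factor_pi)
  define k e where "k = m div 2" and "e = m mod 2"
  have m: "m = e + k * 2" by (simp add: k_def e_def)
  have "c = to_fract (p * r) / (to_fract r)\<^sup>2"
    using pr by (simp add: power2_eq_square)
  also have "\<dots> = to_fract (v * \<pi> ^ e * (\<pi> ^ k)\<^sup>2) / (to_fract r)\<^sup>2"
    unfolding v(1) by (simp only: m power_add power_mult mult.assoc)
  also have "\<dots> = to_fract (v * \<pi> ^ e) * (to_fract (\<pi> ^ k) / to_fract r)\<^sup>2"
    by (simp only: to_fract_mult[of _ "(\<pi> ^ k)\<^sup>2"] to_fract_power[of "\<pi> ^ k"] power_divide times_divide_eq_right)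
  finally have "c = to_fract (v * \<pi> ^ e) * (to_fract (\<pi> ^ k) / to_fract r)\<^sup>2" .
  moreover have "to_fract (\<pi> ^ k) / to_fract r \<noteq> 0" using pr(2) pi_nz by simp
  moreover have "e < 2" by (simp add: e_def)
  ultimately show ?thesis using v(2) by blast
qed

text \<open>Diagonalise over the fraction field, change each coefficient by a square to a unit times
  \<open>\<pi> ^ e\<close> with \<open>e < 2\<close>, and sort the indices by \<open>e\<close>. The
  scaling factors may be fractions, so integral representations come only afterwards, from
  \<open>form_descent\<close>.\<close>

lemma anisotropic_unit_prime_form:
  fixes a :: "nat \<Rightarrow> nat \<Rightarrow> 'r"
  assumes aniso: "anisotropic n a"
  obtains A B u where "unit_prime_form \<pi> T A B u" "A \<union> B = {..<n}"
    "\<And>x. (\<exists>w. to_fract x = qf_frac n a w) \<longleftrightarrow> (\<exists>z. x = unit_prime_form.form \<pi> A B u z)"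
proof -
  have "\<exists>c. range (qf_frac n a) = range (diag_form {..<n} c) \<and>
      (\<forall>x. diag_form {..<n} c x = 0 \<longrightarrow> (\<forall>i<n. x i = 0))"
    unfolding qf_frac_def
    by (rule anisotropic_diagonalisation[OF two_fract_nz])
      (use aniso in \<open>simp add: anisotropic_def qf_frac_def\<close>)
  then obtain c where c: "range (qf_frac n a) = range (diag_form {..<n} c)"
      "\<And>x i. diag_form {..<n} c x = 0 \<Longrightarrow> i < n \<Longrightarrow> x i = 0" by blast
  have cnz: "c i \<noteq> 0" if "i < n" for i
  proof
    assume "c i = 0"
    then have "diag_form {..<n} c (\<lambda>j. if j = i then 1 else 0) = 0"
      unfolding diag_form_def by (intro sum.neutral) auto
    from c(2)[OF this that] show False by simp
  qed
  have "\<forall>i\<in>{..<n}. \<exists>t v e. e < 2 \<and> t \<noteq> 0 \<and> \<not> \<pi> dvd v \<and> c i = to_fract (v * \<pi> ^ e) * t\<^sup>2"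
    using fract_square_class cnz by (metis lessThan_iff)
  then obtain t v e where tve: "\<And>i. i < n \<Longrightarrow> e i < (2::nat) \<and> t i \<noteq> 0 \<and> \<not> \<pi> dvd v i \<and>
      c i = to_fract (v i * \<pi> ^ e i) * (t i)\<^sup>2"
    unfolding bchoice_iff by auto
  define A where "A = {i. i < n \<and> e i = 0}"
  define B where "B = {i. i < n \<and> e i = 1}"
  define F where "F z = diag_form A v z + \<pi> * diag_form B v z" for z
  have AB: "A \<union> B = {..<n}" "A \<inter> B = {}" "finite A" "finite B"
    using tve unfolding A_def B_def by (auto simp: less_2_cases_iff)
  have Fsum: "F z = (\<Sum>i<n. v i * \<pi> ^ e i * (z i)\<^sup>2)" for z
  proof -
    have "(\<Sum>i<n. v i * \<pi> ^ e i * (z i)\<^sup>2) =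
        (\<Sum>i\<in>A. v i * \<pi> ^ e i * (z i)\<^sup>2) + (\<Sum>i\<in>B. v i * \<pi> ^ e i * (z i)\<^sup>2)"
      unfolding AB(1)[symmetric] using AB by (intro sum.union_disjoint)
    also have "(\<Sum>i\<in>A. v i * \<pi> ^ e i * (z i)\<^sup>2) = diag_form A v z"
      unfolding diag_form_def by (rule sum.cong) (auto simp: A_def)
    also have "(\<Sum>i\<in>B. v i * \<pi> ^ e i * (z i)\<^sup>2) = \<pi> * diag_form B v z"
      unfolding diag_form_def sum_distrib_left by (rule sum.cong) (auto simp: B_def)
    finally show ?thesis by (simp add: F_def)
  qed
  \<comment> \<open>The substitution \<open>z i = t i * y i\<close> absorbs the squares
    \<open>(t i)\<^sup>2\<close> of the coefficients \<open>c i\<close>.\<close>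
  have G: "to_fract (F z) = diag_form {..<n} c (\<lambda>i. y i)"
    if "\<And>i. i < n \<Longrightarrow> to_fract (z i) = t i * y i" for z y
    unfolding Fsum diag_form_def to_fract_sum
  proof (rule sum.cong[OF refl])
    fix i assume "i \<in> {..<n}"
    then have i: "i < n" by simp
    show "to_fract (v i * \<pi> ^ e i * (z i)\<^sup>2) = c i * (y i)\<^sup>2"
      using tve[OF i] that[OF i]
      by (simp add: to_fract_power power_mult_distrib mult_ac)
  qed
  have G': "to_fract (F z) = diag_form {..<n} c (\<lambda>i. to_fract (z i) / t i)" for z
    by (rule G) (use tve in auto)
  have Faniso: "z i = 0" if "F z = 0" "i < n" for z i
    using G'[of z] that c(2)[of "\<lambda>i. to_fract (z i) / t i" i] tve[of i] by simp
  have resA: "residually_anisotropic A v"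
  proof (rule anisotropic_imp_residually)
    fix z assume z: "diag_form A v z = 0"
    \<comment> \<open>Padding a zero of one block by 0 gives a zero of the whole form
      \<open>F\<close>, whose anisotropy is known.\<close>
    have "diag_form A v (\<lambda>i. if i \<in> A then z i else 0) = diag_form A v z"
      by (rule diag_form_cong) simp
    moreover have "diag_form B v (\<lambda>i. if i \<in> A then z i else 0) = 0"
      by (rule diag_form_zero) (use AB in auto)
    ultimately have "F (\<lambda>i. if i \<in> A then z i else 0) = 0" using z by (simp add: F_def)
    then have "(if i \<in> A then z i else 0) = 0" if "i < n" for i using that by (rule Faniso)
    then show "\<forall>i\<in>A. z i = 0" using AB(1) by (metis Un_iff lessThan_iff)
  qed (use AB tve in \<open>auto simp: A_def\<close>)
  have resB: "residually_anisotropic B v"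
  proof (rule anisotropic_imp_residually)
    fix z assume z: "diag_form B v z = 0"
    have "diag_form B v (\<lambda>i. if i \<in> B then z i else 0) = diag_form B v z"
      by (rule diag_form_cong) simp
    moreover have "diag_form A v (\<lambda>i. if i \<in> B then z i else 0) = 0"
      by (rule diag_form_zero) (use AB in auto)
    ultimately have "F (\<lambda>i. if i \<in> B then z i else 0) = 0" using z by (simp add: F_def)
    then have "(if i \<in> B then z i else 0) = 0" if "i < n" for i using that by (rule Faniso)
    then show "\<forall>i\<in>B. z i = 0" using AB(1) by (metis Un_iff lessThan_iff)
  qed (use AB tve in \<open>auto simp: B_def\<close>)
  have up: "unit_prime_form \<pi> T A B v"
  proof unfold_locales
    fix i assume "i \<in> A \<union> B"
    then show "\<not> \<pi> dvd v i" using AB(1) tve by auto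
  qed (use AB resA resB in auto)
  interpret unit_prime_form \<pi> T A B v by (rule up)
  have formF: "form z = F z" for z by (simp add: form_def F_def)
  have "(\<exists>w. to_fract x = qf_frac n a w) \<longleftrightarrow> (\<exists>z. x = form z)" for x
  proof
    assume "\<exists>w. to_fract x = qf_frac n a w"
    then have "to_fract x \<in> range (qf_frac n a)" by blast
    then obtain y where y: "to_fract x = diag_form {..<n} c y" unfolding c(1) by blast
    \<comment> \<open>Denominators are cleared from \<open>t i * y i\<close>, the coordinates in
      which \<open>F\<close> is expressed.\<close>
    obtain s z where s: "s \<noteq> 0" "\<forall>i<n. to_fract s * (t i * y i) = to_fract (z i)"
      using common_denominator[of n "\<lambda>i. t i * y i"] by blast
    have "to_fract (F z) = diag_form {..<n} c (\<lambda>i. to_fract s * y i)"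
      by (rule G) (use s(2) in \<open>simp add: mult.left_commute\<close>)
    also have "\<dots> = to_fract (s\<^sup>2 * x)"
      unfolding diag_form_scale y[symmetric] to_fract_mult to_fract_power ..
    finally have "s\<^sup>2 * x = form z" by (simp only: to_fract_eq_iff formF)
    with s(1) show "\<exists>z. x = form z" using form_descent by blast
  next
    assume "\<exists>z. x = form z"
    then obtain z where "x = F z" using formF by auto
    then have "to_fract x \<in> range (diag_form {..<n} c)" using G' by simp
    then show "\<exists>w. to_fract x = qf_frac n a w" unfolding c(1)[symmetric] by blast
  qed
  then show thesis using that[OF up AB(1)] by blast
qed

text \<open>If \<pi> divides \<open>(z i)\<^sup>2 - \<epsilon> * (z j)\<^sup>2\<close> and
  \<open>z j\<close> is a unit, then \<epsilon> is a square modulo \<pi>. Allowing any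
  \<open>I\<close> inside the pair covers all ranks up to 2.\<close>

lemma residually_anisotropic_pair:
  assumes \<epsilon>: "\<not> \<pi> dvd \<epsilon>" "\<not> residue_square \<epsilon>" and ij: "i \<noteq> j" and I: "I \<subseteq> {i, j}"
    and u: "i \<in> I \<Longrightarrow> u i = 1" "j \<in> I \<Longrightarrow> u j = - \<epsilon>"
  shows "residually_anisotropic I u"
  unfolding residually_anisotropic_def
proof (intro allI impI)
  fix z assume z: "\<pi> dvd diag_form I u z"
  consider "I = {}" | "I = {i}" | "I = {j}" | "I = {i, j}" using I by blast
  then show "\<forall>k\<in>I. \<pi> dvd z k"
  proof cases
    case 4
    have "diag_form I u z = (z i)\<^sup>2 - \<epsilon> * (z j)\<^sup>2"
      using ij u unfolding 4 by (simp add: diag_form_def)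
    with z have d: "\<pi> dvd (z i)\<^sup>2 - \<epsilon> * (z j)\<^sup>2" by simp
    have j: "\<pi> dvd z j"
    proof (rule ccontr)
      assume "\<not> \<pi> dvd z j"
      then have "residue_square \<epsilon>"
        using residue_square_cong[OF d] residue_square_square residue_square_mult_square_iff by blast
      with \<epsilon> show False by simp
    qed
    then have "\<pi> dvd z i"
      using pi_dvd_cong[OF d] pi_dvd_mult_iff pi_dvd_power2_iff by blast
    with j show ?thesis unfolding 4 by simp
  qed (use z u \<epsilon> in \<open>auto simp: diag_form_def pi_dvd_mult_iff pi_dvd_power2_iff\<close>)
qed

end

text \<open>For an ADC form the integral values are exactly the ring elements represented over the
  fraction field, and the normal form describes these.\<close>

lemma (in odd_complete_dvr_haar) ADC_density:
  assumes "anisotropic n a" "ADC n a"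
  shows "\<exists>r s. r \<le> 2 \<and> s \<le> 2 \<and> r + s = n \<and>
    qf_density \<mu> n a = (real r * real (card T) + real s) / (2 * (real (card T) + 1))"
proof -
  obtain A B u where up: "unit_prime_form \<pi> T A B u" and AB: "A \<union> B = {..<n}"
    and vals: "\<And>x. (\<exists>w. to_fract x = qf_frac n a w) \<longleftrightarrow> (\<exists>z. x = unit_prime_form.form \<pi> A B u z)"
    using anisotropic_unit_prime_form[OF assms(1)] by blast
  interpret unit_prime_form \<pi> T A B u by (rule up)
  interpret unit_prime_form_haar \<pi> T A B u \<mu> by unfold_locales
  have "range (qf n a) = range form"
  proof (intro equalityI subsetI)
    fix x assume "x \<in> range (qf n a)"
    then have "\<exists>w. to_fract x = qf_frac n a w" by (metis imageE qf_frac_to_fract)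
    then show "x \<in> range form" using vals by blast
  next
    fix x assume "x \<in> range form"
    then have "\<exists>w. to_fract x = qf_frac n a w" using vals by blast
    then show "x \<in> range (qf n a)" using assms(2) unfolding ADC_def to_fract_def by blast
  qed
  then have "qf_density \<mu> n a =
      (real (card A) * real (card T) + real (card B)) / (2 * (real (card T) + 1))"
    unfolding qf_density_def nonzero_values_def by (simp only: measure_form_values)
  moreover have "card A \<le> 2" "card B \<le> 2"
    using fin units res_aniso residually_anisotropic_card[of A u] residually_anisotropic_card[of B u]
    by simp_all
  moreover have "card A + card B = n"
    using card_Un_disjoint[OF fin disj] AB by simp
  ultimately show ?thesis by blast
qed

lemma (in odd_complete_dvr_haar) ADC_density_occurs:
  assumes "r \<le> 2" "s \<le> 2"
  shows "\<exists>a. nondegenerate (r + s) a \<and> anisotropic (r + s) a \<and> ADC (r + s) a \<and>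
    qf_density \<mu> (r + s) a = (real r * real (card T) + real s) / (2 * (real (card T) + 1))"
proof -
  obtain \<epsilon> where \<epsilon>: "\<not> \<pi> dvd \<epsilon>" "\<not> residue_square \<epsilon>" using ex_nonsquare_unit by blast
  let ?n = "r + s"
  \<comment> \<open>The indices \<open>0\<close> and \<open>r\<close> start the two blocks, so each
    block is an initial segment of \<open>(1, - \<epsilon>)\<close>. For \<open>r = 0\<close> they
    coincide and \<open>A\<close> is empty.\<close>
  define u where "u = (\<lambda>i. if i = 0 \<or> i = r then 1 else - \<epsilon>)"
  define A where "A = {..<r}"
  define B where "B = {r..<r + s}"
  have AB: "A \<union> B = {..<?n}" by (auto simp: A_def B_def)
  have resA: "residually_anisotropic A u"
    by (rule residually_anisotropic_pair[OF \<epsilon>, of 0 1]) (use assms in \<open>auto simp: A_def u_def\<close>)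
  have resB: "residually_anisotropic B u"
    by (rule residually_anisotropic_pair[OF \<epsilon>, of r "Suc r"]) (use assms in \<open>auto simp: B_def u_def\<close>)
  interpret unit_prime_form \<pi> T A B u
  proof unfold_locales
    show "\<not> \<pi> dvd u i" for i using \<epsilon> pi_not_unit by (simp add: u_def)
  qed (use resA resB in \<open>auto simp: A_def B_def\<close>)
  interpret unit_prime_form_haar \<pi> T A B u \<mu> by unfold_locales
  define d where "d = (\<lambda>i. if i < r then u i else \<pi> * u i)"
  define a where "a = (\<lambda>i j. if i = j then d i else 0)"
  have qf_a: "qf ?n a z = form z" for z
  proof -
    have "qf ?n a z = (\<Sum>i\<in>A \<union> B. d i * (z i)\<^sup>2)"
      unfolding a_def qf_diagonal AB by (simp add: diag_form_def)
    also have "\<dots> = (\<Sum>i\<in>A. d i * (z i)\<^sup>2) + (\<Sum>i\<in>B. d i * (z i)\<^sup>2)"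
      using fin disj by (rule sum.union_disjoint)
    also have "(\<Sum>i\<in>A. d i * (z i)\<^sup>2) = diag_form A u z"
      unfolding diag_form_def by (rule sum.cong) (auto simp: A_def d_def)
    also have "(\<Sum>i\<in>B. d i * (z i)\<^sup>2) = \<pi> * diag_form B u z"
      unfolding diag_form_def sum_distrib_left by (rule sum.cong) (auto simp: B_def d_def)
    finally show ?thesis by (simp add: form_def)
  qed
  \<comment> \<open>A common denominator multiplies the value by its square; this reduces both
    anisotropy and ADC to statements about \<open>form\<close> over the ring.\<close>
  have clear: "\<exists>s z. s \<noteq> 0 \<and> (\<forall>i<?n. to_fract s * w i = to_fract (z i)) \<and>
      to_fract (form z) = (to_fract s)\<^sup>2 * qf_frac ?n a w" for w
  proof -
    obtain s z where s: "s \<noteq> 0" "\<forall>i<?n. to_fract s * w i = to_fract (z i)"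
      using common_denominator by blast
    have "to_fract (form z) = qf_frac ?n a (\<lambda>i. to_fract (z i))"
      by (simp only: qf_frac_to_fract qf_a)
    also have "\<dots> = qf_frac ?n a (\<lambda>i. to_fract s * w i)"
      unfolding qf_frac_def by (rule qf_cong) (use s in simp)
    also have "\<dots> = (to_fract s)\<^sup>2 * qf_frac ?n a w"
      unfolding qf_frac_def by (rule qf_scale)
    finally show ?thesis using s by blast
  qed
  have aniso: "anisotropic ?n a"
    unfolding anisotropic_def
  proof (intro allI impI)
    fix w i assume w: "qf_frac ?n a w = 0" and i: "i < ?n"
    obtain s z where s: "s \<noteq> 0" "\<forall>i<?n. to_fract s * w i = to_fract (z i)"
        "to_fract (form z) = (to_fract s)\<^sup>2 * qf_frac ?n a w"
      using clear[of w] by blast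
    have "form z = 0" using s(3) w by simp
    moreover have "i \<in> A \<union> B" using i AB by blast
    ultimately have "z i = 0" by (rule form_anisotropic)
    then show "w i = 0" using s i by (metis mult_eq_0_iff to_fract_eq_0_iff)
  qed
  have "ADC ?n a"
    unfolding ADC_def
  proof (intro allI impI)
    fix x assume "\<exists>w. Fract x 1 = qf_frac ?n a w"
    then obtain w where w: "to_fract x = qf_frac ?n a w" unfolding to_fract_def by blast
    obtain s z where s: "s \<noteq> 0" "to_fract (form z) = (to_fract s)\<^sup>2 * qf_frac ?n a w"
      using clear[of w] by blast
    then have "to_fract (form z) = to_fract (s\<^sup>2 * x)"
      by (simp only: w to_fract_mult to_fract_power)
    then have "s\<^sup>2 * x = form z" by (simp only: to_fract_eq_iff)
    then obtain y where "x = form y" using form_descent[OF s(1)] by blast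
    then show "\<exists>w'. x = qf ?n a w'" using qf_a by metis
  qed
  moreover have "nondegenerate ?n a"
    using two_fract_nz aniso by (rule anisotropic_imp_nondegenerate)
  moreover have "qf_density \<mu> ?n a = (real r * real (card T) + real s) / (2 * (real (card T) + 1))"
  proof -
    have "qf ?n a = form" using qf_a by blast
    then have "qf_density \<mu> ?n a = measure \<mu> (range form - {0})"
      by (simp add: qf_density_def nonzero_values_def)
    then show ?thesis unfolding measure_form_values by (simp add: A_def B_def)
  qed
  ultimately show ?thesis using aniso by blast
qed

section \<open>Discrete valuation rings\<close>

lemma module_mult: "module ((*) :: 'r::comm_ring_1 \<Rightarrow> 'r \<Rightarrow> 'r)"
  by unfold_locales (simp_all add: algebra_simps)

lemma ring_ideal_iff:
  "ring_ideal I \<longleftrightarrow> 0 \<in> I \<and> (\<forall>x\<in>I. \<forall>y\<in>I. x + y \<in> I) \<and> (\<forall>c. \<forall>x\<in>I. c * x \<in> I)"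
  unfolding ring_ideal_def by (rule module.subspace_def[OF module_mult])

lemma span_singleton_eq_multiples: "module.span (*) {a} = {x :: 'r::comm_ring_1. a dvd x}"
  unfolding module.span_singleton[OF module_mult] by (auto simp: dvd_def mult.commute)

lemma ring_ideal_multiples: "ring_ideal {x. a dvd x}"
  by (simp add: ring_ideal_iff)

text \<open>Zorn's lemma on the ideals containing \<open>x\<close> but not 1 yields a maximal ideal,
  which must be the only one there is.\<close>

lemma (in discrete_valuation_ring) nonunit_in_maximal:
  assumes "\<not> x dvd 1"
  shows "x \<in> \<mm>"
proof -
  let ?A = "{J. ring_ideal J \<and> x \<in> J \<and> 1 \<notin> J}"
  have "{y. x dvd y} \<in> ?A" using assms ring_ideal_multiples by simp
  then have ne: "?A \<noteq> {}" by blast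
  have chain: "\<Union>\<C> \<in> ?A" if C: "\<C> \<noteq> {}" "subset.chain ?A \<C>" for \<C>
  proof -
    have CA: "\<And>J. J \<in> \<C> \<Longrightarrow> ring_ideal J \<and> x \<in> J \<and> 1 \<notin> J"
      using C(2) unfolding subset.chain_def by blast
    have "y + z \<in> \<Union>\<C>" if yz: "y \<in> \<Union>\<C>" "z \<in> \<Union>\<C>" for y z
    proof -
      obtain J K where JK: "J \<in> \<C>" "K \<in> \<C>" "y \<in> J" "z \<in> K" using yz by blast
      then have "J \<subseteq> K \<or> K \<subseteq> J" using C(2) unfolding subset_chain_def by blast
      then obtain L where "L \<in> \<C>" "y \<in> L" "z \<in> L" using JK by blast
      then show ?thesis using CA[of L] unfolding ring_ideal_iff by blast
    qed
    moreover have "0 \<in> \<Union>\<C>" using C(1) CA unfolding ring_ideal_iff by blast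
    moreover have "\<forall>c. \<forall>y\<in>\<Union>\<C>. c * y \<in> \<Union>\<C>" using CA unfolding ring_ideal_iff by blast
    ultimately have "ring_ideal (\<Union>\<C>)" unfolding ring_ideal_iff by blast
    then show ?thesis using C(1) CA by blast
  qed
  obtain M where M: "M \<in> ?A" "\<forall>X\<in>?A. M \<subseteq> X \<longrightarrow> X = M"
    using subset_Zorn_nonempty[OF ne chain] by blast
  have "maximal_ring_ideal M"
    unfolding maximal_ring_ideal_def
  proof (intro conjI allI impI)
    show "ring_ideal M" "M \<noteq> UNIV" using M(1) by auto
    fix J assume J: "ring_ideal J \<and> M \<subseteq> J"
    show "J = M \<or> J = UNIV"
    proof (cases "1 \<in> J")
      case True
      then have "c * 1 \<in> J" for c using J unfolding ring_ideal_iff by blast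
      then show ?thesis by auto
    next
      case False
      then show ?thesis using J M by blast
    qed
  qed
  then have "M = \<mm>" by (rule local)
  with M(1) show ?thesis by blast
qed

lemma (in discrete_valuation_ring) uniformizer:
  obtains \<pi> where "\<mm> = {x. \<pi> dvd x}" "\<pi> \<noteq> 0" "\<not> \<pi> dvd 1"
    "\<forall>x. \<not> \<pi> dvd x \<longrightarrow> x dvd 1" "\<forall>x. (\<forall>k. \<pi> ^ k dvd x) \<longrightarrow> x = 0"
proof -
  have "ring_ideal \<mm>" "\<mm> \<noteq> UNIV" using maximal unfolding maximal_ring_ideal_def by auto
  then obtain \<pi> where m: "\<mm> = {x. \<pi> dvd x}"
    using principal[of \<mm>] unfolding span_singleton_eq_multiples by blast
  have nz: "\<pi> \<noteq> 0" using not_field m by auto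
  have nu: "\<not> \<pi> dvd 1"
  proof
    assume "\<pi> dvd 1"
    then have "\<pi> dvd x" for x by (rule dvd_trans) simp
    with \<open>\<mm> \<noteq> UNIV\<close> m show False by simp
  qed
  have units: "x dvd 1" if "\<not> \<pi> dvd x" for x
    using nonunit_in_maximal[of x] that m by auto
  \<comment> \<open>The intersection of the ideals of all \<open>\<pi> ^ k\<close> is principal,
    generated by some \<open>b\<close>. Writing \<open>b = \<pi> * c\<close>, the element
    \<open>c\<close> lies in it again, so \<open>c = b * d\<close> and
    \<open>b * (1 - \<pi> * d) = 0\<close>, which forces \<open>b = 0\<close>.\<close>
  have sep: "x = 0" if x: "\<And>k. \<pi> ^ k dvd x" for x
  proof -
    let ?J = "{x. \<forall>k. \<pi> ^ k dvd x}"
    have "ring_ideal ?J" by (auto simp: ring_ideal_iff)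
    then obtain b where b: "?J = {x. b dvd x}"
      using principal[of ?J] unfolding span_singleton_eq_multiples by blast
    have "b \<in> ?J" unfolding b by simp
    then have bJ: "\<pi> ^ k dvd b" for k by blast
    obtain c where c: "b = \<pi> * c" using bJ[of 1] by (auto elim: dvdE)
    have "\<pi> ^ k dvd c" for k
      using bJ[of "Suc k"] nz by (simp add: c)
    then have "c \<in> ?J" by blast
    then have "b dvd c" unfolding b by simp
    then obtain d where "c = b * d" by (rule dvdE)
    then have "b * (1 - \<pi> * d) = 0" using c by (simp add: algebra_simps)
    moreover have "1 - \<pi> * d \<noteq> 0" using nu by (metis dvd_triv_left eq_iff_diff_eq_0)
    ultimately have "b = 0" by simp
    moreover have "x \<in> ?J" using x by blast
    then have "b dvd x" unfolding b by simp
    ultimately show ?thesis by simp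
  qed
  show thesis by (rule that[OF m nz nu]) (use units sep in blast)+
qed

lemma ideal_power_multiples:
  "ideal_power {x :: 'r::comm_ring_1. p dvd x} k = {x. p ^ k dvd x}"
proof (induction k)
  case (Suc k)
  let ?S = "{x * y | x y. x \<in> {x. p dvd x} \<and> y \<in> {x. p ^ k dvd x}}"
  have "module.span (*) ?S = {x. p ^ Suc k dvd x}"
  proof
    show "module.span (*) ?S \<subseteq> {x. p ^ Suc k dvd x}"
    proof (rule module.span_minimal[OF module_mult])
      show "?S \<subseteq> {x. p ^ Suc k dvd x}" by (auto intro: mult_dvd_mono)
      show "module.subspace (*) {x. p ^ Suc k dvd x}"
        using ring_ideal_multiples unfolding ring_ideal_def .
    qed
    have "x \<in> ?S" if "p ^ Suc k dvd x" for x
    proof -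
      obtain c where "x = p * (p ^ k * c)" using \<open>p ^ Suc k dvd x\<close> by (auto simp: mult.assoc)
      moreover have "p dvd p" "p ^ k dvd p ^ k * c" by simp_all
      ultimately show ?thesis by blast
    qed
    then show "{x. p ^ Suc k dvd x} \<subseteq> module.span (*) ?S"
      using module.span_superset[OF module_mult, of ?S] by blast
  qed
  then show ?case using Suc by simp
qed simp

lemma residue_representatives:
  fixes \<mm> :: "'r::comm_ring_1 set"
  assumes "ring_ideal \<mm>"
  obtains T where "bij_betw (\<lambda>t. {y. t - y \<in> \<mm>}) T (residue_field \<mm>)"
    "\<forall>x. \<exists>!t. t \<in> T \<and> x - t \<in> \<mm>"
proof -
  have neg: "- x \<in> \<mm>" if "x \<in> \<mm>" for x
    using assms that unfolding ring_ideal_iff by (metis mult_minus1)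
  have add: "x + y \<in> \<mm>" if "x \<in> \<mm>" "y \<in> \<mm>" for x y
    using assms that unfolding ring_ideal_iff by blast
  have sym: "y - x \<in> \<mm>" if "x - y \<in> \<mm>" for x y
    using neg[OF that] by simp
  have tr: "x - z \<in> \<mm>" if "x - y \<in> \<mm>" "y - z \<in> \<mm>" for x y z
    using add[OF that] by simp
  have refl: "x - x \<in> \<mm>" for x
    using assms unfolding ring_ideal_iff by simp
  \<comment> \<open>Congruent elements define the same predicate under \<open>SOME\<close>, so one
    representative is chosen per class.\<close>
  define rp where "rp x = (SOME y. x - y \<in> \<mm>)" for x
  have rp: "x - rp x \<in> \<mm>" for x
    unfolding rp_def using refl by (rule someI)
  have rp_eq: "rp x = rp y" if "x - y \<in> \<mm>" for x y
  proof -
    have "(\<lambda>z. x - z \<in> \<mm>) = (\<lambda>z. y - z \<in> \<mm>)"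
      using that sym tr by blast
    then show ?thesis by (simp add: rp_def)
  qed
  define T where "T = range rp"
  have unique: "rp y = rp x" if "x - rp y \<in> \<mm>" for x y
    using rp_eq[OF tr[OF that sym[OF rp[of y]]]] by simp
  have ex1: "\<exists>!t. t \<in> T \<and> x - t \<in> \<mm>" for x
  proof (rule ex1I[of _ "rp x"])
    show "rp x \<in> T \<and> x - rp x \<in> \<mm>" using rp by (simp add: T_def)
    show "t = rp x" if "t \<in> T \<and> x - t \<in> \<mm>" for t
      using that unique by (auto simp: T_def)
  qed
  have "bij_betw (\<lambda>t. {y. t - y \<in> \<mm>}) T (residue_field \<mm>)"
  proof (rule bij_betw_imageI)
    show "inj_on (\<lambda>t. {y. t - y \<in> \<mm>}) T"
    proof (rule inj_onI)
      fix s t assume st: "s \<in> T" "t \<in> T" "{y. s - y \<in> \<mm>} = {y. t - y \<in> \<mm>}"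
      have "t \<in> {y. t - y \<in> \<mm>}" using refl by simp
      then have "s - t \<in> \<mm>" using st(3) by blast
      then show "s = t" using ex1[of s] st refl by blast
    qed
    have "{y. rp x - y \<in> \<mm>} = {y. x - y \<in> \<mm>}" for x
      using rp sym tr by blast
    then show "(\<lambda>t. {y. t - y \<in> \<mm>}) ` T = residue_field \<mm>"
      unfolding T_def residue_field_def quotient_def Image_def by auto
  qed
  then show thesis by (rule that) (use ex1 in blast)
qed

text \<open>This passes from ideals to divisibility by \<pi>. Cosets of the ideal of
  \<open>\<pi> ^ k\<close> are open, hence measurable, and translates of each other.\<close>

lemma (in complete_discrete_valuation_ring) odd_complete_dvr_haar:
  assumes fin: "finite (residue_field \<mm>)" and odd: "odd (card (residue_field \<mm>))"
    and haar: "normalised_haar_measure \<mm> \<mu>"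
  obtains \<pi> T where "odd_complete_dvr_haar \<pi> T \<mu>" "card T = card (residue_field \<mm>)"
proof -
  obtain \<pi> where m: "\<mm> = {x. \<pi> dvd x}" and pi: "\<pi> \<noteq> 0" "\<not> \<pi> dvd 1"
    "\<forall>x. \<not> \<pi> dvd x \<longrightarrow> x dvd 1" "\<forall>x. (\<forall>k. \<pi> ^ k dvd x) \<longrightarrow> x = 0"
    by (rule uniformizer)
  have pow: "ideal_power \<mm> k = {x. \<pi> ^ k dvd x}" for k
    unfolding m by (rule ideal_power_multiples)
  have "ring_ideal \<mm>" unfolding m by (rule ring_ideal_multiples)
  then obtain T where T: "bij_betw (\<lambda>t. {y. t - y \<in> \<mm>}) T (residue_field \<mm>)"
      "\<forall>x. \<exists>!t. t \<in> T \<and> x - t \<in> \<mm>" by (rule residue_representatives)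
  have cardT: "card T = card (residue_field \<mm>)" using T(1) by (rule bij_betw_same_card)
  have "odd_complete_dvr_haar \<pi> T \<mu>"
  proof unfold_locales
    show "\<pi> \<noteq> 0" "\<not> \<pi> dvd 1" by (fact pi)+
    show "x dvd 1" if "\<not> \<pi> dvd x" for x using that pi(3) by blast
    show "x = 0" if "\<And>k. \<pi> ^ k dvd x" for x using that pi(4) by blast
    show "\<exists>l. \<forall>k. \<exists>N. \<forall>i\<ge>N. \<pi> ^ k dvd s i - l"
      if "\<And>k. \<exists>N. \<forall>i\<ge>N. \<forall>j\<ge>N. \<pi> ^ k dvd s i - s j" for s :: "nat \<Rightarrow> 'r"
      using complete[of s] that unfolding pow by simp
    show "finite T" using T(1) fin bij_betw_finite by blast
    show "\<exists>!t. t \<in> T \<and> \<pi> dvd x - t" for x using T(2)[rule_format, of x] unfolding m by simp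
    show "odd (card T)" using odd cardT by simp
    show "space \<mu> = UNIV" "emeasure \<mu> UNIV = 1"
      using haar unfolding normalised_haar_measure_def by simp_all
    show meas: "{y. \<pi> ^ k dvd y - x} \<in> sets \<mu>" for k x
    proof -
      have "adic_open \<mm> {y. \<pi> ^ k dvd y - x}"
        unfolding adic_open_def pow
      proof (intro ballI exI[of _ k] allI impI)
        fix z y assume "z \<in> {y. \<pi> ^ k dvd y - x}" "y - z \<in> {x. \<pi> ^ k dvd x}"
        then have "\<pi> ^ k dvd (y - z) + (z - x)" by (intro dvd_add) simp_all
        then show "y \<in> {y. \<pi> ^ k dvd y - x}" by simp
      qed
      then show ?thesis
        using haar unfolding normalised_haar_measure_def by (simp add: sigma_sets.Basic)
    qed
    show "measure \<mu> {y. \<pi> ^ k dvd y - x} = measure \<mu> {y. \<pi> ^ k dvd y - 0}" for k x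
    proof -
      have "{y. \<pi> ^ k dvd y - x} = (\<lambda>y. x + y) ` {y. \<pi> ^ k dvd y - 0}"
      proof (intro equalityI subsetI)
        fix y assume "y \<in> {y. \<pi> ^ k dvd y - x}"
        then show "y \<in> (\<lambda>y. x + y) ` {y. \<pi> ^ k dvd y - 0}"
          by (intro image_eqI[of _ _ "y - x"]) auto
      qed auto
      then show ?thesis
        using haar meas[of k 0] unfolding normalised_haar_measure_def measure_def by metis
    qed
  qed
  then show thesis using cardT by (rule that)
qed

theorem theorem2p5:
  fixes \<mm> :: "'r::idom set" and q :: nat and \<mu> :: "'r measure"
  assumes "complete_discrete_valuation_ring \<mm>"
    and "finite (residue_field \<mm>)" and "card (residue_field \<mm>) = q" and "odd q"
    and "CHAR('r fract) \<noteq> 2"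
    and "normalised_haar_measure \<mm> \<mu>"
  shows
    "((\<forall>a :: nat \<Rightarrow> nat \<Rightarrow> 'r. nondegenerate 2 a \<and> anisotropic 2 a \<and> ADC 2 a \<longrightarrow>
         qf_density \<mu> 2 a \<in> {real q / (real q + 1), 1 / 2, 1 / (real q + 1)}) \<and>
      (\<forall>d \<in> {real q / (real q + 1), 1 / 2, 1 / (real q + 1)}.
         \<exists>a :: nat \<Rightarrow> nat \<Rightarrow> 'r. nondegenerate 2 a \<and> anisotropic 2 a \<and> ADC 2 a \<and>
           qf_density \<mu> 2 a = d)) \<and>
     ((\<forall>a :: nat \<Rightarrow> nat \<Rightarrow> 'r. nondegenerate 3 a \<and> anisotropic 3 a \<and> ADC 3 a \<longrightarrow>
         qf_density \<mu> 3 a \<in> {(real q + 2) / (2 * real q + 2), (2 * real q + 1) / (2 * real q + 2)}) \<and>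
      (\<forall>d \<in> {(real q + 2) / (2 * real q + 2), (2 * real q + 1) / (2 * real q + 2)}.
         \<exists>a :: nat \<Rightarrow> nat \<Rightarrow> 'r. nondegenerate 3 a \<and> anisotropic 3 a \<and> ADC 3 a \<and>
           qf_density \<mu> 3 a = d)) \<and>
     (\<forall>n \<ge> 4. \<forall>a :: nat \<Rightarrow> nat \<Rightarrow> 'r. nondegenerate n a \<and> anisotropic n a \<and> ADC n a \<longrightarrow>
         qf_density \<mu> n a = 1)"
proof -
  interpret complete_discrete_valuation_ring \<mm> by fact
  have "odd (card (residue_field \<mm>))" using assms by simp
  then obtain \<pi> T where H: "odd_complete_dvr_haar \<pi> T \<mu>" and "card T = card (residue_field \<mm>)"
    by (rule odd_complete_dvr_haar[OF assms(2) _ assms(6)])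
  then have q: "card T = q" using assms(3) by simp
  interpret odd_complete_dvr_haar \<pi> T \<mu> by (rule H)
  \<comment> \<open>\<open>\<delta> r s\<close> is the density for blocks of ranks \<open>r\<close>
    and \<open>s\<close>.\<close>
  define \<delta> where "\<delta> r s = (real r * real q + real s) / (2 * (real q + 1))" for r s
  have q1: "real q + 1 \<noteq> 0" "2 * real q + 2 \<noteq> 0" by linarith+
  have \<delta>: "\<delta> 2 0 = real q / (real q + 1)" "\<delta> 1 1 = 1 / 2" "\<delta> 0 2 = 1 / (real q + 1)"
    "\<delta> 1 2 = (real q + 2) / (2 * real q + 2)" "\<delta> 2 1 = (2 * real q + 1) / (2 * real q + 2)"
    "\<delta> 2 2 = 1"
    using q1 by (simp_all add: \<delta>_def divide_simps)
  have dens: "\<exists>r s. r \<le> 2 \<and> s \<le> 2 \<and> r + s = n \<and> qf_density \<mu> n a = \<delta> r s"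
    if "nondegenerate n a \<and> anisotropic n a \<and> ADC n a" for n a
    using ADC_density[of n a] that unfolding q \<delta>_def by simp
  have occ: "\<exists>a. nondegenerate n a \<and> anisotropic n a \<and> ADC n a \<and> qf_density \<mu> n a = \<delta> r s"
    if "r \<le> 2" "s \<le> 2" "n = r + s" for r s n
    using ADC_density_occurs[OF that(1,2)] unfolding q \<delta>_def that(3) .
  show ?thesis
  proof (intro conjI allI impI ballI)
    fix a :: "nat \<Rightarrow> nat \<Rightarrow> 'r" assume "nondegenerate 2 a \<and> anisotropic 2 a \<and> ADC 2 a"
    then obtain r s where rs: "r \<le> 2" "s \<le> 2" "r + s = 2" "qf_density \<mu> 2 a = \<delta> r s"
      using dens by blast
    then have "(r = 2 \<and> s = 0) \<or> (r = 1 \<and> s = 1) \<or> (r = 0 \<and> s = 2)" by presburger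
    then show "qf_density \<mu> 2 a \<in> {real q / (real q + 1), 1 / 2, 1 / (real q + 1)}"
      unfolding \<delta>(1-3)[symmetric] using rs(4) by blast
  next
    fix d assume "d \<in> {real q / (real q + 1), 1 / 2, 1 / (real q + 1)}"
    then have "d \<in> {\<delta> 2 0, \<delta> 1 1, \<delta> 0 2}" unfolding \<delta> .
    then show "\<exists>a :: nat \<Rightarrow> nat \<Rightarrow> 'r. nondegenerate 2 a \<and> anisotropic 2 a \<and> ADC 2 a \<and>
        qf_density \<mu> 2 a = d"
      using occ[of 2 0 2] occ[of 1 1 2] occ[of 0 2 2] by auto
  next
    fix a :: "nat \<Rightarrow> nat \<Rightarrow> 'r" assume "nondegenerate 3 a \<and> anisotropic 3 a \<and> ADC 3 a"
    then obtain r s where rs: "r \<le> 2" "s \<le> 2" "r + s = 3" "qf_density \<mu> 3 a = \<delta> r s"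
      using dens by blast
    then have "(r = 1 \<and> s = 2) \<or> (r = 2 \<and> s = 1)" by presburger
    then show "qf_density \<mu> 3 a \<in> {(real q + 2) / (2 * real q + 2), (2 * real q + 1) / (2 * real q + 2)}"
      unfolding \<delta>(4,5)[symmetric] using rs(4) by blast
  next
    fix d assume "d \<in> {(real q + 2) / (2 * real q + 2), (2 * real q + 1) / (2 * real q + 2)}"
    then have "d \<in> {\<delta> 1 2, \<delta> 2 1}" unfolding \<delta> .
    then show "\<exists>a :: nat \<Rightarrow> nat \<Rightarrow> 'r. nondegenerate 3 a \<and> anisotropic 3 a \<and> ADC 3 a \<and>
        qf_density \<mu> 3 a = d"
      using occ[of 1 2 3] occ[of 2 1 3] by auto
  next
    fix n :: nat and a :: "nat \<Rightarrow> nat \<Rightarrow> 'r"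
    assume "n \<ge> 4" "nondegenerate n a \<and> anisotropic n a \<and> ADC n a"
    \<comment> \<open>Both ranks are at most 2, so \<open>n \<ge> 4\<close> leaves only the pair (2,
      2); beyond 4 variables the assumptions are contradictory.\<close>
    then obtain r s where rs: "r \<le> 2" "s \<le> 2" "r + s = n" "qf_density \<mu> n a = \<delta> r s"
      using dens by blast
    with \<open>n \<ge> 4\<close> have "r = 2" "s = 2" by linarith+
    with rs(4) show "qf_density \<mu> n a = 1" by (simp only: \<delta>)
  qed
qed

end
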